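(* Let $H=\bigoplus_{i=1}^m H_i$ be the direct sum of separable real Hilbert spaces $H_1,\dots,H_m$, let $f\colon H\to\mathbb{R}$ be convex and differentiable, let $h_i\colon H_i\to\,]-\infty,+\infty]$ be proper, convex and lower semicontinuous for $i=1,\dots,m$, and set $h(x)=\sum_{i=1}^m h_i(x_i)$ and $F=f+h$. Let $\varepsilon=(\varepsilon_1,\dots,\varepsilon_m)$ be a $\{0,1\}^m$-valued random variable with $p_i:=\mathsf{P}(\varepsilon_i=1)>0$ for every $i$ and $\mathsf{P}(\varepsilon=(0,\dots,0))=0$, and let $(\varepsilon^n)_{n\in\mathbb{N}}$ be a sequence of independent copies of $\varepsilon$. Let $(\nu_i)_{1\le i\le m}\in\,]0,+\infty[^m$ be such that $$(\forall x,v\in H)\quad \mathsf{E}[f(x+\varepsilon\odot v)]\le f(x)+\mathsf{E}[\langle\nabla f(x),\varepsilon\odot v\rangle]+\frac12\sum_{i=1}^m p_i\nu_i\|v_i\|^2 .$$ Let $0<\gamma_i<2/\nu_i$ for every $i\in\{1,\dots,m\}$, let $x^0\in\operatorname{dom}h$ be deterministic, and let $(x^n)_{n\in\mathbb{N}}$ be the sequence of $H$-valued random variables defined by $$x_i^{n+1}=x_i^n+\varepsilon_i^n\big(\mathrm{prox}_{\gamma_i h_i}(x_i^n-\gamma_i\nabla_i f(x^n))-x_i^n\big),\qquad i=1,\dots,m,\ n\in\mathbb{N}.$$ Set $\delta=\max_{i}\gamma_i\nu_i$, $p_{\min}=\min_{i}p_i$, and $F_*=\inf F$. Let $\mu,\sigma\ge0$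 be moduli of strong convexity of $f$ and $h$, respectively, in the norm $\|\cdot\|_{\Gamma^{-1}}$; suppose that $\mu+\sigma>0$ and that $\operatorname{argmin}F=\{x_*\}$. Then, for every $n\in\mathbb{N}$, $$\mathsf{E}[F(x^n)]-F_*\le(1-p_{\min}\bar\lambda)^n\left(p_{\min}\big(1+\sigma-(\delta-1)_+\big)\frac{\|x^0-x_*\|_W^2}{2}+F(x^0)-F_*\right),$$ where $$\bar\lambda=\begin{cases}\dfrac{2-\delta+\sigma}{1+\sigma}&\text{if }\delta>1\text{ and }\mu\ge2-\delta,\\[2ex]\dfrac{2(\mu+\sigma)}{1+\sigma+(\mu+\sigma)(1+\sigma)/(1+\sigma-(\delta-1)_+)}&\text{otherwise.}\end{cases}$$
   Context: $H=\bigoplus_i H_i$ carries the inner product $\langle x,y\rangle=\sum_{i=1}^m\langle x_i,y_i\rangle$; $\nabla_i f(x)\in H_i$ is the $i$-th component of $\nabla f(x)$. For $v\in H$ and $\epsilon\in\{0,1\}^m$, $\epsilon\odot v=(\epsilon_iv_i)_{1\le i\le m}\in H$. For a proper convex lower semicontinuous function $\varphi$ on a Hilbert space, $\mathrm{prox}_\varphi(x)=\operatorname{argmin}_z\ \varphi(z)+\frac12\|x-z\|^2$. For $t\in\mathbb{R}$, $t_+=\max\{t,0\}$. The weighted norms are $\|x\|_{\Gamma^{-1}}^2=\sum_{i=1}^m\frac1{\gamma_i}\|x_i\|^2$ and $\|x\|_W^2=\sum_{i=1}^m\frac{1}{\gamma_ip_i}\|x_i\|^2$. That $\mu,\sigma\ge0$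 are moduli of strong convexity of $f$ and $h$ in the norm $\|\cdot\|_{\Gamma^{-1}}$ means that for all $x,y\in H$: $f(y)\ge f(x)+\langle\nabla f(x),y-x\rangle+\frac{\mu}{2}\|y-x\|_{\Gamma^{-1}}^2$ and, for every $v\in\partial h(x)$ (usual subdifferential), $h(y)\ge h(x)+\langle v,y-x\rangle+\frac{\sigma}{2}\|y-x\|_{\Gamma^{-1}}^2$. *)

theory Defs
  imports "HOL-Probability.Probability"
begin

text \<open>
  The spaces \<open>H\<^sub>1, \<dots>, H\<^sub>m\<close> may differ, so they are modelled as complete separable linear subspaces
  \<open>S i\<close> of one ambient inner product space (which itself need be neither complete nor separable);
  every finite family of separable Hilbert spaces arises in this way inside its direct sum. All
  functions are only constrained on, and all notions below are relative to, these carriers. The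
  index type \<open>'m::finite\<close> plays the role of \<open>{1, \<dots>, m}\<close>, and the inner product of the library
  type \<open>'a ^ 'm\<close> is the sum of the inner products of the components.
\<close>

definition separable_hilbert :: "'a::real_inner set \<Rightarrow> bool" where
  "separable_hilbert S \<longleftrightarrow> subspace S \<and> Topological_Spaces.complete S \<and> separable_space (top_of_set S)"

definition direct_sum :: "('m::finite \<Rightarrow> 'a::real_inner set) \<Rightarrow> ('a ^ 'm) set" where
  "direct_sum S = {x. \<forall>i. x $ i \<in> S i}"

text \<open>Elements of \<open>{0,1}\<^sup>m\<close> are functions \<open>'m \<Rightarrow> bool\<close>, with \<open>True\<close> for 1.\<close>

definition mask :: "('m::finite \<Rightarrow> bool) \<Rightarrow> 'a::real_vector ^ 'm \<Rightarrow> 'a ^ 'm" (infixr \<open>\<odot>\<close> 75) where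
  "e \<odot> v = (\<chi> i. of_bool (e i) *\<^sub>R (v $ i))"

definition wnorm_sq :: "('m::finite \<Rightarrow> real) \<Rightarrow> 'a::real_inner ^ 'm \<Rightarrow> real" where
  "wnorm_sq w x = (\<Sum>i\<in>UNIV. w i * (norm (x $ i))\<^sup>2)"

definition proper_on :: "'a set \<Rightarrow> ('a \<Rightarrow> ereal) \<Rightarrow> bool" where
  "proper_on S \<phi> \<longleftrightarrow> (\<forall>x\<in>S. \<phi> x \<noteq> -\<infinity>) \<and> (\<exists>x\<in>S. \<phi> x \<noteq> \<infinity>)"

definition ereal_convex_on :: "'a::real_vector set \<Rightarrow> ('a \<Rightarrow> ereal) \<Rightarrow> bool" where
  "ereal_convex_on S \<phi> \<longleftrightarrow> convex S \<and>
     (\<forall>x\<in>S. \<forall>y\<in>S. \<forall>t\<in>{0<..<1}.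
        \<phi> ((1 - t) *\<^sub>R x + t *\<^sub>R y) \<le> ereal (1 - t) * \<phi> x + ereal t * \<phi> y)"

definition lsc_on :: "'a::topological_space set \<Rightarrow> ('a \<Rightarrow> ereal) \<Rightarrow> bool" where
  "lsc_on S \<phi> \<longleftrightarrow> (\<forall>x\<in>S. \<phi> x \<le> Liminf (at x within S) \<phi>)"

definition prox_on :: "'a::real_inner set \<Rightarrow> ('a \<Rightarrow> ereal) \<Rightarrow> 'a \<Rightarrow> 'a" where
  "prox_on S \<phi> x = arg_min_on (\<lambda>z. \<phi> z + ereal (1 / 2 * (norm (x - z))\<^sup>2)) S"

definition gradient_on :: "'a::real_inner set \<Rightarrow> ('a \<Rightarrow> real) \<Rightarrow> 'a \<Rightarrow> 'a" where
  "gradient_on S f x = (THE g. g \<in> S \<and> (f has_derivative (\<lambda>v. g \<bullet> v)) (at x within S))"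

definition subdifferential_on :: "'a::real_inner set \<Rightarrow> ('a \<Rightarrow> ereal) \<Rightarrow> 'a \<Rightarrow> 'a set" where
  "subdifferential_on S \<phi> x = {v\<in>S. \<forall>y\<in>S. \<phi> x + ereal (v \<bullet> (y - x)) \<le> \<phi> y}"

definition smooth_strong_convexity_modulus ::
    "('a::real_inner ^ 'm::finite) set \<Rightarrow> ('m \<Rightarrow> real) \<Rightarrow> ('a ^ 'm \<Rightarrow> real) \<Rightarrow> real \<Rightarrow> bool" where
  "smooth_strong_convexity_modulus S w f \<mu> \<longleftrightarrow> 0 \<le> \<mu> \<and>
     (\<forall>x\<in>S. \<forall>y\<in>S. f y \<ge> f x + gradient_on S f x \<bullet> (y - x) + \<mu> / 2 * wnorm_sq w (y - x))"

definition strong_convexity_modulus ::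
    "('a::real_inner ^ 'm::finite) set \<Rightarrow> ('m \<Rightarrow> real) \<Rightarrow> ('a ^ 'm \<Rightarrow> ereal) \<Rightarrow> real \<Rightarrow> bool" where
  "strong_convexity_modulus S w h \<sigma> \<longleftrightarrow> 0 \<le> \<sigma> \<and>
     (\<forall>x\<in>S. \<forall>y\<in>S. \<forall>v\<in>subdifferential_on S h x.
        h y \<ge> h x + ereal (v \<bullet> (y - x)) + ereal (\<sigma> / 2 * wnorm_sq w (y - x)))"

text \<open>
  Expectation of an extended real random variable, as the integral of the positive part minus that
  of the negative part; since \<open>\<infinity> - \<infinity> = \<infinity>\<close> in \<open>ereal\<close>, an upper bound on it is never vacuous.
\<close>

definition ereal_expectation :: "'w measure \<Rightarrow> ('w \<Rightarrow> ereal) \<Rightarrow> ereal" where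
  "ereal_expectation M X =
     enn2ereal (\<integral>\<^sup>+\<omega>. e2ennreal (X \<omega>) \<partial>M) - enn2ereal (\<integral>\<^sup>+\<omega>. e2ennreal (- X \<omega>) \<partial>M)"

definition lambda_bar :: "real \<Rightarrow> real \<Rightarrow> real \<Rightarrow> real" where
  "lambda_bar \<delta> \<mu> \<sigma> =
     (if \<delta> > 1 \<and> \<mu> \<ge> 2 - \<delta> then (2 - \<delta> + \<sigma>) / (1 + \<sigma>)
      else 2 * (\<mu> + \<sigma>) / (1 + \<sigma> + (\<mu> + \<sigma>) * (1 + \<sigma>) / (1 + \<sigma> - max (\<delta> - 1) 0)))"

end

theory Submission
  imports Defs
begin

text \<open>
  Write \<open>T x\<close> for the full proximal gradient step, \<open>A, B, C\<close> for the squared \<open>\<Gamma>\<^sup>-\<^sup>1\<close>-norms of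
  \<open>x - x\<^sub>*\<close>, \<open>T x - x\<^sub>*\<close>, \<open>T x - x\<close>, \<open>D = F x - F\<^sub>*\<close> and \<open>c = 1 + \<sigma> - (\<delta> - 1)\<^sub>+\<close>. One random step
  changes the expected value of \<open>F\<close> by at most \<open>p\<^sub>m\<^sub>i\<^sub>n G\<close>, where \<open>G\<close> is bounded by
  \<open>- D + (1 - \<mu>)/2 A - (1 + \<sigma>)/2 B + (\<delta> - 1)/2 C\<close> (strong convexity, compared with \<open>x\<^sub>*\<close>) and by
  \<open>- (2 + \<sigma> - \<delta>)/2 C\<close> (compared with \<open>x\<close>), and it changes the expected value of
  \<open>\<parallel>x - x\<^sub>*\<parallel>\<^sub>W\<^sup>2\<close> by \<open>B - A\<close>. The convex combination of the two bounds that eliminates \<open>C\<close>, together with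
  \<open>D \<ge> (\<mu> + \<sigma>)/2 A\<close> and \<open>p\<^sub>m\<^sub>i\<^sub>n \<parallel>x - x\<^sub>*\<parallel>\<^sub>W\<^sup>2 \<le> A\<close>, shows that
  \<open>D + p\<^sub>m\<^sub>i\<^sub>n c \<parallel>x - x\<^sub>*\<parallel>\<^sub>W\<^sup>2 / 2\<close> contracts in expectation by \<open>1 - p\<^sub>m\<^sub>i\<^sub>n \<lambda>\<close>, where \<open>\<lambda>\<close> is the constant
  \<open>lambda_bar \<delta> \<mu> \<sigma>\<close>. Here \<open>\<mu> \<le> \<delta>\<close> unless the space is trivial, which keeps the rate nonnegative.
\<close>

subsection \<open>The proximity operator\<close>

text \<open>Parallelogram law seen from the midpoint; its negative last term is what makes
  minimizing sequences Cauchy.\<close>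

lemma norm_midpoint_sq:
  fixes a b u :: "'a::real_inner"
  shows "(norm (u - (1/2) *\<^sub>R (a + b)))\<^sup>2 = (norm (u - a))\<^sup>2 / 2 + (norm (u - b))\<^sup>2 / 2 - (norm (a - b))\<^sup>2 / 4"
  unfolding power2_norm_eq_inner
  by (simp add: inner_diff_left inner_diff_right inner_add_left inner_add_right inner_commute field_simps)

text \<open>Closed sublevel sets bound \<open>r\<close> from below near \<open>a\<close>; convexity propagates this bound to all of
  the domain along rays through \<open>a\<close>.\<close>

lemma convex_linear_lower_bound:
  fixes r :: "'a::real_normed_vector \<Rightarrow> real"
  assumes conv: "convex_on D r" and aD: "a \<in> D"
    and sub: "\<forall>z l c. (\<forall>n. z n \<in> D \<and> r (z n) \<le> c) \<longrightarrow> z \<longlonglongrightarrow> l \<longrightarrow> l \<in> S \<longrightarrow> l \<in> D \<and> r l \<le> c"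
    and DS: "D \<subseteq> S"
  obtains L where "0 \<le> L" "\<And>z. z \<in> D \<Longrightarrow> r a - 1 - L * norm (z - a) \<le> r z"
proof -
  \<comment> \<open>Otherwise points of the sublevel set at height \<open>r a - 1\<close> would
    converge to \<open>a\<close>, and closedness would put \<open>a\<close> itself into that
    set.\<close>
  have "\<exists>\<rho>>0. \<forall>z\<in>D. norm (z - a) < \<rho> \<longrightarrow> r a - 1 < r z"
  proof (rule ccontr)
    assume "\<not> ?thesis"
    then have "\<forall>n. \<exists>z\<in>D. norm (z - a) < inverse (real (Suc n)) \<and> r z \<le> r a - 1"
      by (metis inverse_positive_iff_positive of_nat_0_less_iff zero_less_Suc not_le)
    then obtain z where z: "\<And>n. z n \<in> D" "\<And>n. norm (z n - a) < inverse (real (Suc n))" "\<And>n. r (z n) \<le> r a - 1"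
      by metis
    have "(\<lambda>n. z n - a) \<longlonglongrightarrow> 0"
      by (rule Lim_null_comparison[OF _ LIMSEQ_inverse_real_of_nat])
        (use z(2) in \<open>auto intro!: always_eventually less_imp_le\<close>)
    then have "z \<longlonglongrightarrow> a"
      using LIM_zero_iff by blast
    with sub z aD DS have "r a \<le> r a - 1" by blast
    then show False by simp
  qed
  then obtain \<rho> where \<rho>: "\<rho> > 0" "\<And>z. z \<in> D \<Longrightarrow> norm (z - a) < \<rho> \<Longrightarrow> r a - 1 < r z" by blast
  have "r a - 1 - (2 / \<rho>) * norm (z - a) \<le> r z" if zD: "z \<in> D" for z
  proof (cases "norm (z - a) < \<rho>")
    case True
    then show ?thesis using \<rho>(2)[OF zD True] \<rho>(1)
      by (smt (verit, best) divide_nonneg_pos mult_nonneg_nonneg norm_ge_zero)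
  next
    case False
    \<comment> \<open>This \<open>t\<close> puts \<open>w\<close> at distance
      \<open>\<rho> / 2\<close> from \<open>a\<close>, inside the ball where the local bound holds;
      solving the convexity inequality for \<open>r z\<close> produces the slope
      \<open>2 / \<rho>\<close>.\<close>
    define t where "t = \<rho> / (2 * norm (z - a))"
    have d: "norm (z - a) \<ge> \<rho>" "norm (z - a) > 0" using False \<rho> by auto
    have t: "0 < t" "t \<le> 1" using d \<rho> by (auto simp: t_def field_simps)
    define w where "w = (1 - t) *\<^sub>R a + t *\<^sub>R z"
    have "w \<in> D" "r w \<le> (1 - t) * r a + t * r z"
      using convex_onD[OF conv, of t a z] t aD zD convex_on_imp_convex[OF conv]
      unfolding w_def by (auto simp: convex_alt)
    moreover have "w - a = t *\<^sub>R (z - a)" by (simp add: w_def algebra_simps)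
    then have "norm (w - a) = \<rho> / 2" using \<rho> d by (simp add: t_def)
    ultimately have "r a - 1 < (1 - t) * r a + t * r z" using \<rho> by fastforce
    then have "t * (r a - r z) < 1" by (simp add: algebra_simps)
    then have "r a - r z < (2 / \<rho>) * norm (z - a)" using t \<rho> d by (simp add: t_def field_simps)
    then show ?thesis by simp
  qed
  moreover have "0 \<le> 2 / \<rho>" using \<rho> by simp
  ultimately show ?thesis using that by blast
qed

text \<open>The quadratic outweighs the linear minorant of \<open>r\<close>, so the infimum is
  finite; its strong convexity makes a minimizing sequence Cauchy; completeness of \<open>S\<close>
  and the closed sublevel sets then give a limit in \<open>D\<close> that attains the
  infimum.\<close>

lemma prox_minimizer_exists:
  fixes r :: "'a::real_inner \<Rightarrow> real"
  assumes conv: "convex_on D r" and ne: "D \<noteq> {}" and DS: "D \<subseteq> S" and S: "Topological_Spaces.complete S"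
    and sub: "\<forall>z l c. (\<forall>n. z n \<in> D \<and> r (z n) \<le> c) \<longrightarrow> z \<longlonglongrightarrow> l \<longrightarrow> l \<in> S \<longrightarrow> l \<in> D \<and> r l \<le> c"
  obtains z where "z \<in> D" "\<And>y. y \<in> D \<Longrightarrow> r z + 1/2 * (norm (u - z))\<^sup>2 \<le> r y + 1/2 * (norm (u - y))\<^sup>2"
proof -
  define J where "J = (\<lambda>z. r z + 1/2 * (norm (u - z))\<^sup>2)"
  obtain a where aD: "a \<in> D" using ne by blast
  obtain L where L: "0 \<le> L" "\<And>z. z \<in> D \<Longrightarrow> r a - 1 - L * norm (z - a) \<le> r z"
    using convex_linear_lower_bound[OF conv aD sub DS] by metis
  define k where "k = norm (u - a)"
  \<comment> \<open>The constant \<open>L\<^sup>2 / 2\<close> comes from completing the square in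
    \<open>s\<^sup>2 / 2 - L * s\<close>.\<close>
  have "r a - 1 - L * k - L\<^sup>2 / 2 \<le> J z" if zD: "z \<in> D" for z
  proof -
    define s where "s = norm (u - z)"
    have "norm (z - a) \<le> s + k" unfolding s_def k_def
      using norm_triangle_ineq[of "z - u" "u - a"] by (simp add: norm_minus_commute)
    then have "L * norm (z - a) \<le> L * (s + k)" using L by (intro mult_left_mono)
    moreover have "0 \<le> (s - L)\<^sup>2" by simp
    ultimately show ?thesis using L(2)[OF zD] unfolding J_def s_def[symmetric]
      by (simp add: power2_eq_square algebra_simps)
  qed
  then have bdd: "bdd_below (J ` D)" by (meson bdd_belowI2)
  define I where "I = Inf (J ` D)"
  have I: "I \<le> J z" if "z \<in> D" for z unfolding I_def using bdd that by (simp add: cInf_lower)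
  have "\<exists>z\<in>D. J z < I + inverse (real (Suc n))" for n
    using cInf_lessD[of "J ` D" "I + inverse (real (Suc n))"] ne unfolding I_def by fastforce
  then obtain z where zD: "\<And>n. z n \<in> D" and zJ: "\<And>n. J (z n) < I + inverse (real (Suc n))"
    by metis
  \<comment> \<open>At the midpoint \<open>J\<close> is at least \<open>I\<close> and at most the
    mean of \<open>J a\<close> and \<open>J b\<close> minus an eighth of the squared
    distance.\<close>
  have par: "(norm (a - b))\<^sup>2 \<le> 4 * (J a + J b - 2 * I)" if "a \<in> D" "b \<in> D" for a b
  proof -
    have m: "(1/2) *\<^sub>R (a + b) = (1 - 1/2) *\<^sub>R a + (1/2) *\<^sub>R b" by (simp add: algebra_simps)
    have "(1/2) *\<^sub>R (a + b) \<in> D" "r ((1/2) *\<^sub>R (a + b)) \<le> r a / 2 + r b / 2"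
      using convex_onD[OF conv, of "1/2" a b] that
        convexD_alt[OF convex_on_imp_convex[OF conv], of a b "1/2"]
      unfolding m by auto
    with I[of "(1/2) *\<^sub>R (a + b)"] show ?thesis
      unfolding J_def norm_midpoint_sq by (simp add: algebra_simps)
  qed
  have "Cauchy z"
  proof (rule metric_CauchyI)
    fix e :: real assume e: "e > 0"
    \<comment> \<open>\<open>par\<close> multiplies the sum of two excesses over \<open>I\<close> by
      4, hence the margin \<open>e\<^sup>2 / 8\<close> for each.\<close>
    then obtain N where N: "inverse (real (Suc N)) < e\<^sup>2 / 8"
      using reals_Archimedean[of "e\<^sup>2 / 8"] by auto
    have "dist (z m) (z n) < e" if "m \<ge> N" "n \<ge> N" for m n
    proof -
      have i: "inverse (real (Suc m)) \<le> inverse (real (Suc N))" "inverse (real (Suc n)) \<le> inverse (real (Suc N))"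
        using that by (auto intro!: le_imp_inverse_le)
      have J8: "J (z k) < I + e\<^sup>2 / 8" if "inverse (real (Suc k)) \<le> inverse (real (Suc N))" for k
        using zJ[of k] that N by linarith
      have "(norm (z m - z n))\<^sup>2 < e\<^sup>2"
        using par[OF zD zD, of m n] J8[OF i(1)] J8[OF i(2)] by simp
      then show ?thesis using e by (simp add: dist_norm power2_less_imp_less)
    qed
    then show "\<exists>M. \<forall>m\<ge>M. \<forall>n\<ge>M. dist (z m) (z n) < e" by blast
  qed
  then obtain l where l: "l \<in> S" "z \<longlonglongrightarrow> l"
    using S zD DS unfolding complete_def by (metis subsetD)
  have lim: "(\<lambda>n. I + inverse (real (Suc n)) - 1/2 * (norm (u - z n))\<^sup>2) \<longlonglongrightarrow> I + 0 - 1/2 * (norm (u - l))\<^sup>2"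
    by (intro tendsto_intros LIMSEQ_inverse_real_of_nat l)
  \<comment> \<open>Closedness needs one level for the whole sequence, so the limit of the upper
    bounds is raised by \<open>e\<close> and a tail is taken; \<open>e\<close> disappears
    afterwards.\<close>
  have le: "l \<in> D \<and> r l \<le> I - 1/2 * (norm (u - l))\<^sup>2 + e" if e: "e > 0" for e
  proof -
    obtain N where N: "\<And>n. n \<ge> N \<Longrightarrow> I + inverse (real (Suc n)) - 1/2 * (norm (u - z n))\<^sup>2 < I - 1/2 * (norm (u - l))\<^sup>2 + e"
      using order_tendstoD(2)[OF lim, of "I - 1/2 * (norm (u - l))\<^sup>2 + e"] e
      unfolding eventually_sequentially by auto
    have "z (n + N) \<in> D \<and> r (z (n + N)) \<le> I - 1/2 * (norm (u - l))\<^sup>2 + e" for n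
      using zJ[of "n + N"] N[of "n + N"] zD unfolding J_def by simp
    then show ?thesis
      by (rule sub[rule_format, OF _ LIMSEQ_ignore_initial_segment[OF l(2), of N] l(1)])
  qed
  then have "l \<in> D" using zero_less_one by blast
  moreover have "r l \<le> I - 1/2 * (norm (u - l))\<^sup>2"
    by (rule field_le_epsilon) (use le in blast)
  then have "r l + 1/2 * (norm (u - l))\<^sup>2 \<le> r y + 1/2 * (norm (u - y))\<^sup>2" if "y \<in> D" for y
    using I[OF that] unfolding J_def by linarith
  ultimately show ?thesis using that by blast
qed

text \<open>Minimality is tested on the segment from \<open>z\<close> to \<open>y\<close>: dividing
  by \<open>t\<close> and letting \<open>t\<close> tend to 0 from the right removes the quadratic
  error and leaves \<open>u - z\<close> as a subgradient of \<open>r\<close> at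
  \<open>z\<close>.\<close>

lemma prox_variational_inequality:
  fixes r :: "'a::real_inner \<Rightarrow> real"
  assumes conv: "convex_on D r" and z: "z \<in> D" and y: "y \<in> D"
    and min: "\<And>y. y \<in> D \<Longrightarrow> r z + 1/2 * (norm (u - z))\<^sup>2 \<le> r y + 1/2 * (norm (u - y))\<^sup>2"
  shows "r z + (u - z) \<bullet> (y - z) \<le> r y"
proof -
  have *: "r z + (u - z) \<bullet> (y - z) \<le> r y + t * (1/2 * (norm (y - z))\<^sup>2)" if t: "0 < t" "t < 1" for t
  proof -
    define w where "w = (1 - t) *\<^sub>R z + t *\<^sub>R y"
    have w: "w \<in> D" "r w \<le> (1 - t) * r z + t * r y"
      using convex_onD[OF conv, of t z y] t z y convex_on_imp_convex[OF conv]
      unfolding w_def by (auto simp: convex_alt)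
    have uw: "u - w = (u - z) - t *\<^sub>R (y - z)" by (simp add: w_def algebra_simps)
    have "(norm (a - t *\<^sub>R b))\<^sup>2 = (norm a)\<^sup>2 - 2 * t * (a \<bullet> b) + t\<^sup>2 * (norm b)\<^sup>2" for a b :: 'a
      unfolding power2_norm_eq_inner
      by (simp add: inner_diff_left inner_diff_right inner_commute power2_eq_square)
    then have "(norm (u - w))\<^sup>2 = (norm (u - z))\<^sup>2 - 2 * t * ((u - z) \<bullet> (y - z)) + t\<^sup>2 * (norm (y - z))\<^sup>2"
      unfolding uw .
    with min[OF w(1)] w(2)
    have "t * (r z + (u - z) \<bullet> (y - z)) \<le> t * (r y + t * (1/2 * (norm (y - z))\<^sup>2))"
      by (simp add: algebra_simps power2_eq_square)
    then show ?thesis using t by simp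
  qed
  have "((\<lambda>t. r y + t * (1/2 * (norm (y - z))\<^sup>2)) \<longlongrightarrow> r y + 0 * (1/2 * (norm (y - z))\<^sup>2)) (at_right 0)"
    by (intro tendsto_intros)
  then have "((\<lambda>t. r y + t * (1/2 * (norm (y - z))\<^sup>2)) \<longlongrightarrow> r y) (at_right 0)" by simp
  moreover have "eventually (\<lambda>t. r z + (u - z) \<bullet> (y - z) \<le> r y + t * (1/2 * (norm (y - z))\<^sup>2)) (at_right 0)"
    unfolding eventually_at_right_field by (intro exI[of _ 1] conjI allI impI *) simp_all
  ultimately show ?thesis by (rule tendsto_lowerbound) simp
qed

text \<open>The orthogonal projection arises as the proximal point of the zero function, since only
  \<open>S\<close> is assumed complete; the variational inequality at \<open>v + y\<close> and at
  \<open>v - y\<close> yields equality.\<close>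

lemma complete_subspace_projection:
  fixes S :: "'a::real_inner set"
  assumes "subspace S" "Topological_Spaces.complete S"
  obtains v where "v \<in> S" "\<And>y. y \<in> S \<Longrightarrow> v \<bullet> y = w \<bullet> y"
proof -
  have conv: "convex_on S (\<lambda>_. 0::real)" using assms(1) by (simp add: convex_on_def subspace_imp_convex)
  obtain v where v: "v \<in> S" "\<And>y. y \<in> S \<Longrightarrow> 0 + 1/2 * (norm (w - v))\<^sup>2 \<le> 0 + 1/2 * (norm (w - y))\<^sup>2"
    by (rule prox_minimizer_exists[OF conv _ order_refl assms(2), of w])
      (use assms subspace_0 in \<open>auto\<close>)
  have "v \<bullet> y = w \<bullet> y" if y: "y \<in> S" for y
  proof -
    have "v + y \<in> S" "v - y \<in> S" using assms v y by (auto simp: subspace_add subspace_diff)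
    from prox_variational_inequality[OF conv v(1) this(1) v(2)]
      prox_variational_inequality[OF conv v(1) this(2) v(2)]
    show ?thesis by (simp add: inner_diff_left)
  qed
  then show ?thesis using v that by blast
qed

section \<open>Extended real convex functions and their proximity operators\<close>

lemma finite_on_domain:
  assumes "proper_on S \<phi>" "z \<in> S" "\<phi> z \<noteq> \<infinity>"
  shows "ereal (real_of_ereal (\<phi> z)) = \<phi> z"
  using assms by (intro ereal_real') (auto simp: proper_on_def)

lemma convex_on_domain:
  assumes "proper_on S \<phi>" "ereal_convex_on S \<phi>"
  shows "convex_on {z\<in>S. \<phi> z \<noteq> \<infinity>} (\<lambda>z. real_of_ereal (\<phi> z))"
proof -
  have fin: "ereal (real_of_ereal (\<phi> z)) = \<phi> z" if "z \<in> S" "\<phi> z \<noteq> \<infinity>" for z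
    by (rule finite_on_domain[OF assms(1) that])
  have cS: "convex S" using assms by (simp add: ereal_convex_on_def)
  have *: "\<phi> ((1 - t) *\<^sub>R x + t *\<^sub>R y) \<le> ereal ((1 - t) * real_of_ereal (\<phi> x) + t * real_of_ereal (\<phi> y))"
    if "x \<in> S" "\<phi> x \<noteq> \<infinity>" "y \<in> S" "\<phi> y \<noteq> \<infinity>" "0 < t" "t < 1" for x y t
  proof -
    have "\<phi> ((1 - t) *\<^sub>R x + t *\<^sub>R y) \<le> ereal (1 - t) * \<phi> x + ereal t * \<phi> y"
      using assms(2) that unfolding ereal_convex_on_def by auto
    also have "\<dots> = ereal (1 - t) * ereal (real_of_ereal (\<phi> x)) + ereal t * ereal (real_of_ereal (\<phi> y))"
      using fin that by simp
    finally show ?thesis by simp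
  qed
  have dom: "(1 - t) *\<^sub>R x + t *\<^sub>R y \<in> {z\<in>S. \<phi> z \<noteq> \<infinity>}"
    if "x \<in> S" "\<phi> x \<noteq> \<infinity>" "y \<in> S" "\<phi> y \<noteq> \<infinity>" "0 < t" "t < 1" for x y t
    using *[OF that] convexD_alt[OF cS that(1,3), of t] that by auto
  have "convex {z\<in>S. \<phi> z \<noteq> \<infinity>}"
    unfolding convex_alt
  proof (intro ballI allI impI)
    fix x y and t :: real
    assume "x \<in> {z\<in>S. \<phi> z \<noteq> \<infinity>}" "y \<in> {z\<in>S. \<phi> z \<noteq> \<infinity>}" "0 \<le> t \<and> t \<le> 1"
    \<comment> \<open>\<open>ereal_convex_on\<close> speaks of \<open>0 < t < 1\<close> only, so the
      endpoints are separate.\<close>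
    then show "(1 - t) *\<^sub>R x + t *\<^sub>R y \<in> {z\<in>S. \<phi> z \<noteq> \<infinity>}"
      using dom[of x y t] by (cases "t = 0 \<or> t = 1") auto
  qed
  then show ?thesis
  proof (intro convex_onI)
    fix t x y assume "0 < t" "t < (1::real)" "x \<in> {z\<in>S. \<phi> z \<noteq> \<infinity>}" "y \<in> {z\<in>S. \<phi> z \<noteq> \<infinity>}"
    then show "real_of_ereal (\<phi> ((1 - t) *\<^sub>R x + t *\<^sub>R y)) \<le> (1 - t) * real_of_ereal (\<phi> x) + t * real_of_ereal (\<phi> y)"
      using *[of x y t] dom[of x y t] fin[of "(1 - t) *\<^sub>R x + t *\<^sub>R y"] by (auto simp flip: ereal_less_eq(3))
  qed
qed

lemma lsc_on_sequence_bound: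
  fixes \<phi> :: "'a::metric_space \<Rightarrow> ereal"
  assumes lsc: "lsc_on S \<phi>" and z: "\<And>n. z n \<in> S" "\<And>n. \<phi> (z n) \<le> c" "z \<longlonglongrightarrow> l" "l \<in> S"
  shows "\<phi> l \<le> c"
proof (rule ccontr)
  assume "\<not> \<phi> l \<le> c"
  then have "c < Liminf (at l within S) \<phi>" using lsc \<open>l \<in> S\<close> unfolding lsc_on_def
    by (meson less_le_trans not_le)
  from less_LiminfD[OF this] obtain d where d: "d > 0" "\<And>y. y \<in> S \<Longrightarrow> y \<noteq> l \<Longrightarrow> dist y l < d \<Longrightarrow> c < \<phi> y"
    unfolding eventually_at by blast
  obtain n where "dist (z n) l < d" using z(3) d(1) unfolding LIMSEQ_def by blast
  \<comment> \<open>The lower limit ignores \<open>l\<close> itself; if \<open>z n = l\<close>, the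
    bound on \<open>\<phi> (z n)\<close> is already the contradiction.\<close>
  with d(2)[of "z n"] z(1,2)[of n] \<open>\<not> \<phi> l \<le> c\<close> show False by force
qed

text \<open>The problem is reduced to the real function \<open>r\<close> on the domain
  \<open>D\<close>; the variational inequality there, divided by \<open>\<gamma>\<close>, makes
  \<open>(u - P) / \<gamma>\<close> a subgradient of \<open>\<phi>\<close> at
  \<open>P\<close>.\<close>

lemma prox_on_subgradient_inequality:
  fixes \<phi> :: "'a::real_inner \<Rightarrow> ereal" and u :: 'a
  assumes S: "separable_hilbert S" and proper: "proper_on S \<phi>" and conv: "ereal_convex_on S \<phi>"
    and lsc: "lsc_on S \<phi>" and \<gamma>: "\<gamma> > 0"
  defines "P \<equiv> prox_on S (\<lambda>z. ereal \<gamma> * \<phi> z) u"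
  shows "P \<in> S" "\<phi> P \<noteq> \<infinity>"
    "\<And>y. y \<in> S \<Longrightarrow> \<phi> y \<noteq> \<infinity> \<Longrightarrow>
      real_of_ereal (\<phi> P) + (1 / \<gamma>) * ((u - P) \<bullet> (y - P)) \<le> real_of_ereal (\<phi> y)"
proof -
  define D where "D = {z\<in>S. \<phi> z \<noteq> \<infinity>}"
  define r where "r = (\<lambda>z. \<gamma> * real_of_ereal (\<phi> z))"
  have fin: "ereal \<gamma> * \<phi> z = ereal (r z)" if "z \<in> D" for z
    using finite_on_domain[OF proper, of z] that unfolding D_def r_def by (metis (mono_tags, lifting) mem_Collect_eq times_ereal.simps(1))
  have fin': "\<phi> z = ereal (r z / \<gamma>)" if "z \<in> D" for z
    using finite_on_domain[OF proper, of z] that \<gamma> unfolding D_def r_def by simp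
  have cr: "convex_on D r" unfolding r_def D_def
    using convex_on_cmul[OF less_imp_le[OF \<gamma>] convex_on_domain[OF proper conv]] .
  have ne: "D \<noteq> {}" using proper unfolding proper_on_def D_def by auto
  have DS: "D \<subseteq> S" by (auto simp: D_def)
  have comp: "Topological_Spaces.complete S" using S by (simp add: separable_hilbert_def)
  \<comment> \<open>Lower semicontinuity gives a finite bound on \<open>\<phi> l\<close>, which also
    forces \<open>l\<close> into the domain.\<close>
  have sub: "l \<in> D \<and> r l \<le> c"
    if z: "\<forall>n. z n \<in> D \<and> r (z n) \<le> c" and l: "z \<longlonglongrightarrow> l" "l \<in> S" for z l c
  proof -
    have "\<phi> l \<le> ereal (c / \<gamma>)"
    proof (rule lsc_on_sequence_bound[OF lsc _ _ l])
      fix n show "z n \<in> S" using z DS by blast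
      show "\<phi> (z n) \<le> ereal (c / \<gamma>)" using z fin'[of "z n"] \<gamma> by (simp add: divide_right_mono)
    qed
    moreover from this have "l \<in> D" using l by (auto simp: D_def)
    ultimately show ?thesis using fin'[of l] \<gamma> by (simp add: divide_le_cancel)
  qed
  obtain z where z: "z \<in> D" "\<And>y. y \<in> D \<Longrightarrow> r z + 1/2 * (norm (u - z))\<^sup>2 \<le> r y + 1/2 * (norm (u - y))\<^sup>2"
    using prox_minimizer_exists[OF cr ne DS comp, of u] sub by blast
  define J where "J = (\<lambda>z. ereal \<gamma> * \<phi> z + ereal (1 / 2 * (norm (u - z))\<^sup>2))"
  have JD: "J y = ereal (r y + 1/2 * (norm (u - y))\<^sup>2)" if "y \<in> D" for y
    using fin[OF that] by (simp add: J_def)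
  have JnD: "J y = \<infinity>" if "y \<in> S" "y \<notin> D" for y
    using that \<gamma> by (simp add: J_def D_def)
  have "is_arg_min J (\<lambda>y. y \<in> S) z"
    unfolding is_arg_min_linorder
  proof (intro conjI allI impI)
    show "z \<in> S" using z DS by auto
    fix y assume "y \<in> S" then show "J z \<le> J y"
      using z(2)[of y] JD[OF z(1)] JD[of y] JnD[of y] by (cases "y \<in> D") auto
  qed
  \<comment> \<open>\<open>prox_on\<close> chooses some minimizer; the existence of \<open>z\<close>
    guarantees that the chosen \<open>P\<close> is one.\<close>
  then have P: "is_arg_min J (\<lambda>y. y \<in> S) P"
    unfolding P_def prox_on_def arg_min_on_def arg_min_def J_def by (rule someI)
  then have "J P \<le> J z" using z DS by (auto simp: is_arg_min_linorder)
  then have PD: "P \<in> D" using JnD[of P] JD[OF z(1)] P unfolding is_arg_min_linorder by fastforce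
  then show "P \<in> S" "\<phi> P \<noteq> \<infinity>" by (auto simp: D_def)
  have min: "r P + 1/2 * (norm (u - P))\<^sup>2 \<le> r y + 1/2 * (norm (u - y))\<^sup>2" if "y \<in> D" for y
    using P JD[OF PD] JD[OF that] that DS by (auto simp: is_arg_min_linorder)
  fix y assume "y \<in> S" "\<phi> y \<noteq> \<infinity>"
  then have "y \<in> D" by (simp add: D_def)
  from prox_variational_inequality[OF cr PD this min]
  show "real_of_ereal (\<phi> P) + (1 / \<gamma>) * ((u - P) \<bullet> (y - P)) \<le> real_of_ereal (\<phi> y)"
    using \<gamma> unfolding r_def by (simp add: field_simps)
qed

subsection \<open>The contraction constant\<close>

text \<open>Under these hypotheses \<open>lambda_bar\<close> is the smaller of the root of the last
  inequality, taken as an equation in it, and the cap \<open>c / (1 + \<sigma>)\<close>. The root is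
  below the cap exactly when \<open>\<mu> + \<sigma> \<le> c\<close>, which explains the case
  distinction in its definition.\<close>

lemma lambda_bar_bounds:
  fixes \<delta> \<mu> \<sigma> :: real
  defines "c \<equiv> 1 + \<sigma> - max (\<delta> - 1) 0"
  assumes par: "\<delta> < 2" "0 \<le> \<mu>" "0 \<le> \<sigma>" "0 < \<mu> + \<sigma>" "\<mu> \<le> \<delta>"
  shows "0 < c" "0 \<le> lambda_bar \<delta> \<mu> \<sigma>" "lambda_bar \<delta> \<mu> \<sigma> \<le> c / (1 + \<sigma>)" "c / (1 + \<sigma>) \<le> 1"
    "(1 + \<sigma>) * (c / (1 + \<sigma>) - lambda_bar \<delta> \<mu> \<sigma>) * (\<mu> + \<sigma>) + c * (\<mu> + \<sigma> - lambda_bar \<delta> \<mu> \<sigma> * (1 + \<sigma>)) \<ge> 0"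
proof -
  show c: "0 < c" using par unfolding c_def by auto
  show "c / (1 + \<sigma>) \<le> 1" using par unfolding c_def by (subst divide_le_eq_1) auto
  define lam where "lam = lambda_bar \<delta> \<mu> \<sigma>"
  have "0 \<le> lam \<and> lam * (1 + \<sigma>) \<le> c \<and> (c - lam * (1 + \<sigma>)) * (\<mu> + \<sigma>) + c * (\<mu> + \<sigma> - lam * (1 + \<sigma>)) \<ge> 0"
  proof (cases "\<delta> > 1 \<and> \<mu> \<ge> 2 - \<delta>")
    case True
    then have l: "lam = c / (1 + \<sigma>)" and c': "c = 2 - \<delta> + \<sigma>" by (auto simp: lam_def lambda_bar_def c_def)
    have "lam * (1 + \<sigma>) = c" using l par by simp
    moreover have "0 \<le> c * (\<mu> + \<sigma> - c)" using c c' True by (intro mult_nonneg_nonneg) auto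
    ultimately show ?thesis using l c par by simp
  next
    case False
    define m where "m = \<mu> + \<sigma>"
    \<comment> \<open>For \<open>\<delta> \<le> 1\<close> this rests on
      \<open>\<mu> \<le> \<delta>\<close>; for \<open>\<delta> > 1\<close> on the failure of
      \<open>\<mu> \<ge> 2 - \<delta>\<close>.\<close>
    have m: "0 < m" "m \<le> c" using par False unfolding m_def c_def by auto
    have "lam = 2 * m / (1 + \<sigma> + m * (1 + \<sigma>) / c)"
      using False unfolding lam_def lambda_bar_def c_def m_def by auto
    also have "1 + \<sigma> + m * (1 + \<sigma>) / c = (1 + \<sigma>) * (c + m) / c"
      using c by (simp add: add_divide_distrib distrib_left mult.commute)
    finally have l: "lam = 2 * m * c / ((1 + \<sigma>) * (c + m))" by simp
    have l': "lam * (1 + \<sigma>) = 2 * m * c / (c + m)" using par unfolding l by simp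
    have e: "(2 * m * c / (c + m)) * (c + m) = 2 * m * c" using c m by simp
    have "2 * m * c / (c + m) \<le> c" using c m by (simp add: field_simps)
    moreover have "(c - 2 * m * c / (c + m)) * m + c * (m - 2 * m * c / (c + m)) = 0"
      using e by (simp add: algebra_simps add_divide_distrib)
    moreover have "0 \<le> lam" unfolding l using c m par by simp
    ultimately show ?thesis unfolding l' m_def[symmetric] by simp
  qed
  then show "0 \<le> lambda_bar \<delta> \<mu> \<sigma>" "lambda_bar \<delta> \<mu> \<sigma> \<le> c / (1 + \<sigma>)"
    "(1 + \<sigma>) * (c / (1 + \<sigma>) - lambda_bar \<delta> \<mu> \<sigma>) * (\<mu> + \<sigma>) + c * (\<mu> + \<sigma> - lambda_bar \<delta> \<mu> \<sigma> * (1 + \<sigma>)) \<ge> 0"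
    unfolding lam_def[symmetric] using par by (auto simp: pos_le_divide_eq right_diff_distrib mult.commute[of "1 + \<sigma>" lam])
qed

text \<open>The convex combination of the two bounds on \<open>G\<close> with weight \<open>c / (1 + \<sigma>)\<close> on the first one
  eliminates \<open>C\<close>.\<close>

lemma descent_combination:
  fixes A B C D G \<delta> \<mu> \<sigma> :: real
  defines "c \<equiv> 1 + \<sigma> - max (\<delta> - 1) 0"
  assumes par: "\<delta> < 2" "0 \<le> \<mu>" "0 \<le> \<sigma>" "0 < \<mu> + \<sigma>" "\<mu> \<le> \<delta>"
    and nn: "0 \<le> A" "0 \<le> C"
    and G1: "G \<le> - D + (1 - \<mu>) / 2 * A - (1 + \<sigma>) / 2 * B + (\<delta> - 1) / 2 * C"
    and G2: "G \<le> - (2 + \<sigma> - \<delta>) / 2 * C"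
    and D: "(\<mu> + \<sigma>) / 2 * A \<le> D"
  shows "G + c / 2 * (B - A) \<le> - lambda_bar \<delta> \<mu> \<sigma> * (D + c / 2 * A)"
proof -
  define \<theta> lam where "\<theta> = c / (1 + \<sigma>)" and "lam = lambda_bar \<delta> \<mu> \<sigma>"
  note lb = lambda_bar_bounds[OF par, folded c_def lam_def, folded \<theta>_def]
  have \<theta>c: "\<theta> * (1 + \<sigma>) = c" using par by (simp add: \<theta>_def)
  have \<theta>: "0 < \<theta>" using lb(1) par by (simp add: \<theta>_def)
  have "G = \<theta> * G + (1 - \<theta>) * G" by (simp add: algebra_simps)
  also have "\<dots> \<le> \<theta> * (- D + (1 - \<mu>) / 2 * A - (1 + \<sigma>) / 2 * B + (\<delta> - 1) / 2 * C)
      + (1 - \<theta>) * (- (2 + \<sigma> - \<delta>) / 2 * C)"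
    using \<theta> lb(4) G1 G2 by (intro add_mono mult_left_mono) auto
  also have "\<dots> = \<theta> * (- D + (1 - \<mu>) / 2 * A) - (\<theta> * (1 + \<sigma>)) / 2 * B
      + (\<theta> * (1 + \<sigma>) - (2 + \<sigma> - \<delta>)) / 2 * C"
    by (simp add: field_simps)
  also have "\<dots> = \<theta> * (- D + (1 - \<mu>) / 2 * A) - c / 2 * B + (c - (2 + \<sigma> - \<delta>)) / 2 * C"
    unfolding \<theta>c ..
  also have "\<dots> \<le> \<theta> * (- D + (1 - \<mu>) / 2 * A) - c / 2 * B"
  proof -
    \<comment> \<open>The factor is \<open>(\<delta> - 1) - max (\<delta> - 1) 0\<close>: zero for
      \<open>\<delta> \<ge> 1\<close>, negative below.\<close>
    have "(c - (2 + \<sigma> - \<delta>)) / 2 * C \<le> 0"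
      using nn by (intro mult_nonpos_nonneg) (auto simp: c_def)
    then show ?thesis by linarith
  qed
  finally have 1: "G \<le> \<theta> * (- D + (1 - \<mu>) / 2 * A) - c / 2 * B" .
  \<comment> \<open>Only the share \<open>lam\<close> of the coefficient \<open>\<theta>\<close> of
    \<open>D\<close> is kept. The surplus is turned into a multiple of \<open>A\<close> by quadratic
    growth, and the last bound of \<open>lambda_bar_bounds\<close> says that this suffices.\<close>
  have "0 \<le> (\<theta> - lam) * (D - (\<mu> + \<sigma>) / 2 * A)" using lb(3) D by simp
  moreover have "0 \<le> A * ((1 + \<sigma>) * (\<theta> - lam) * (\<mu> + \<sigma>) + c * (\<mu> + \<sigma> - lam * (1 + \<sigma>)))"
    using nn(1) lb(5) by (rule mult_nonneg_nonneg)
  then have "0 \<le> (1 + \<sigma>) * (A * ((\<theta> - lam) * (\<mu> + \<sigma>) + \<theta> * (\<mu> + \<sigma> - lam * (1 + \<sigma>))))"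
    unfolding \<theta>c[symmetric] by (simp add: algebra_simps)
  then have "0 \<le> A * ((\<theta> - lam) * (\<mu> + \<sigma>) + \<theta> * (\<mu> + \<sigma> - lam * (1 + \<sigma>)))"
    using par by (simp add: zero_le_mult_iff)
  ultimately have "0 \<le> (\<theta> - lam) * D + \<theta> * (\<mu> + \<sigma> - lam * (1 + \<sigma>)) / 2 * A"
    by (simp add: field_simps)
  then have "\<theta> * (- D + (1 - \<mu>) / 2 * A) \<le> - lam * D + (1 - lam) * (\<theta> * (1 + \<sigma>)) / 2 * A"
    by (simp add: field_simps)
  then show ?thesis using 1 unfolding \<theta>c lam_def by (simp add: field_simps)
qed

subsection \<open>One step of the method\<close>

lemma wnorm_sq_nonneg: "(\<And>i. 0 \<le> w i) \<Longrightarrow> 0 \<le> wnorm_sq w x"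
  unfolding wnorm_sq_def by (intro sum_nonneg mult_nonneg_nonneg) auto

lemma scaled_prox_inner:
  fixes a b u w :: "'a::real_inner"
  assumes "0 < \<gamma>"
  shows "1 / \<gamma> * ((a - \<gamma> *\<^sub>R u - b) \<bullet> w) = 1 / \<gamma> * ((a - b) \<bullet> w) - u \<bullet> w"
  using assms by (simp add: inner_diff_left diff_divide_distrib)

lemma inner_diff_polarization:
  fixes a b y :: "'a::real_inner"
  shows "(a - b) \<bullet> (y - b) = ((norm (b - a))\<^sup>2 + (norm (y - b))\<^sup>2 - (norm (y - a))\<^sup>2) / 2"
  unfolding power2_norm_eq_inner
  by (simp add: inner_diff_left inner_diff_right inner_commute field_simps)

text \<open>A setting free of measures: the law of one mask is the weight \<open>q\<close>, so
  expectations are finite sums, and \<open>h\<close> is replaced by real functions on the domains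
  \<open>D i\<close>. The map \<open>T\<close> enters only through \<open>T_dom\<close> and
  \<open>prox_ineq\<close>, the subgradient inequality at \<open>T z\<close> sharpened by
  \<open>\<sigma>\<close>.\<close>

locale block_prox_descent =
  fixes Hs D :: "'m::finite \<Rightarrow> 'a::real_inner set"
    and r :: "'m \<Rightarrow> 'a \<Rightarrow> real"
    and f :: "'a ^ 'm \<Rightarrow> real"
    and g T :: "'a ^ 'm \<Rightarrow> 'a ^ 'm"
    and q :: "('m \<Rightarrow> bool) \<Rightarrow> real"
    and p \<nu> \<gamma> :: "'m \<Rightarrow> real"
    and \<delta> \<mu> \<sigma> p_min :: real
    and xs :: "'a ^ 'm"
  assumes subspace_Hs: "\<And>i. subspace (Hs i)"
    and D_subset: "\<And>i. D i \<subseteq> Hs i"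
    and q_nonneg: "\<And>e. 0 \<le> q e"
    and q_sum: "(\<Sum>e\<in>UNIV. q e) = 1"
    and p_eq: "\<And>i. p i = (\<Sum>e\<in>UNIV. q e * of_bool (e i))"
    and p_min_pos: "0 < p_min"
    and p_min_le: "\<And>i. p_min \<le> p i"
    and gamma_pos: "\<And>i. 0 < \<gamma> i"
    and gamma_nu_le: "\<And>i. \<gamma> i * \<nu> i \<le> \<delta>"
    and delta_less: "\<delta> < 2"
    and mu_nonneg: "0 \<le> \<mu>"
    and sigma_nonneg: "0 \<le> \<sigma>"
    and mu_sigma_pos: "0 < \<mu> + \<sigma>"
    and T_dom: "\<And>z. z \<in> direct_sum D \<Longrightarrow> T z \<in> direct_sum D"
    and prox_ineq: "\<And>z y. z \<in> direct_sum D \<Longrightarrow> y \<in> direct_sum D \<Longrightarrow>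
      (\<Sum>i\<in>UNIV. r i (T z $ i))
        + (\<Sum>i\<in>UNIV. 1 / \<gamma> i * ((z $ i - \<gamma> i *\<^sub>R (g z $ i) - T z $ i) \<bullet> (y $ i - T z $ i)))
        + \<sigma> / 2 * wnorm_sq (\<lambda>i. 1 / \<gamma> i) (y - T z) \<le> (\<Sum>i\<in>UNIV. r i (y $ i))"
    and f_strong: "\<And>z y. z \<in> direct_sum Hs \<Longrightarrow> y \<in> direct_sum Hs \<Longrightarrow>
      f z + g z \<bullet> (y - z) + \<mu> / 2 * wnorm_sq (\<lambda>i. 1 / \<gamma> i) (y - z) \<le> f y"
    and f_smooth: "\<And>z v. z \<in> direct_sum Hs \<Longrightarrow> v \<in> direct_sum Hs \<Longrightarrow>
      (\<Sum>e\<in>UNIV. q e * f (z + e \<odot> v))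
        \<le> f z + (\<Sum>e\<in>UNIV. q e * (g z \<bullet> (e \<odot> v))) + 1 / 2 * (\<Sum>i\<in>UNIV. p i * \<nu> i * (norm (v $ i))\<^sup>2)"
    and xs_dom: "xs \<in> direct_sum D"
    and xs_min: "\<And>z. z \<in> direct_sum D \<Longrightarrow>
      f xs + (\<Sum>i\<in>UNIV. r i (xs $ i)) \<le> f z + (\<Sum>i\<in>UNIV. r i (z $ i))"
begin

definition "F z = f z + (\<Sum>i\<in>UNIV. r i (z $ i))"

definition "step z e = z + e \<odot> (T z - z)"

definition "c = 1 + \<sigma> - max (\<delta> - 1) 0"

text \<open>At the starting point this is exactly the bracket of the final bound.\<close>

definition "lyapunov z = F z - F xs + p_min * c / 2 * wnorm_sq (\<lambda>i. 1 / (\<gamma> i * p i)) (z - xs)"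

abbreviation "N \<equiv> wnorm_sq (\<lambda>i. 1 / \<gamma> i) :: 'a ^ 'm \<Rightarrow> real"

section \<open>Elementary facts and averages over one random mask\<close>

lemma p_pos: "0 < p i"
  using p_min_pos p_min_le[of i] by linarith

lemma N_nonneg: "0 \<le> N v"
  using gamma_pos by (intro wnorm_sq_nonneg) (simp add: less_imp_le)

lemma dom_subset: "z \<in> direct_sum D \<Longrightarrow> z \<in> direct_sum Hs"
  using D_subset by (auto simp: direct_sum_def)

lemma diff_Hs: "z \<in> direct_sum Hs \<Longrightarrow> y \<in> direct_sum Hs \<Longrightarrow> z - y \<in> direct_sum Hs"
  using subspace_Hs by (auto simp: direct_sum_def subspace_diff)

lemma step_component: "step z e $ i = (if e i then T z $ i else z $ i)"
  by (simp add: step_def mask_def)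

lemma step_dom: "z \<in> direct_sum D \<Longrightarrow> step z e \<in> direct_sum D"
  using T_dom[of z] by (auto simp: direct_sum_def step_component)

text \<open>By linearity only the marginals \<open>p i\<close> matter, so the blocks of one mask may
  be dependent.\<close>

lemma expectation_mask:
  "(\<Sum>e\<in>UNIV. q e * (K + (\<Sum>i\<in>UNIV. of_bool (e i) * b i))) = K + (\<Sum>i\<in>UNIV. p i * b i)"
proof -
  have "(\<Sum>e\<in>UNIV. q e * (\<Sum>i\<in>UNIV. of_bool (e i) * b i)) = (\<Sum>e\<in>UNIV. \<Sum>i\<in>UNIV. q e * of_bool (e i) * b i)"
    by (simp only: sum_distrib_left mult.assoc)
  also have "\<dots> = (\<Sum>i\<in>UNIV. p i * b i)"
    by (subst sum.swap) (simp only: p_eq sum_distrib_right)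
  finally show ?thesis
    by (simp only: distrib_left sum.distrib q_sum mult_1 flip: sum_distrib_right)
qed

lemma inner_mask: "u \<bullet> (e \<odot> v) = (\<Sum>i\<in>UNIV. of_bool (e i) * (u $ i \<bullet> v $ i))"
  by (simp add: inner_vec_def mask_def)

lemma expectation_inner_mask: "(\<Sum>e\<in>UNIV. q e * (u \<bullet> (e \<odot> v))) = (\<Sum>i\<in>UNIV. p i * (u $ i \<bullet> v $ i))"
  using expectation_mask[of 0 "\<lambda>i. u $ i \<bullet> v $ i"] by (simp add: inner_mask)

text \<open>\<open>prox_ineq\<close> with its inner products polarized into squared distances, ready
  for comparison with the strong convexity of \<open>f\<close>.\<close>

lemma three_point:
  assumes "z \<in> direct_sum D" "y \<in> direct_sum D"
  shows "(\<Sum>i\<in>UNIV. r i (T z $ i)) + (N (T z - z) + N (y - T z) - N (y - z)) / 2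
    - g z \<bullet> (y - T z) + \<sigma> / 2 * N (y - T z) \<le> (\<Sum>i\<in>UNIV. r i (y $ i))"
proof -
  have "1 / \<gamma> i * ((z $ i - \<gamma> i *\<^sub>R (g z $ i) - T z $ i) \<bullet> (y $ i - T z $ i))
    = (1 / \<gamma> i * (norm ((T z - z) $ i))\<^sup>2 + 1 / \<gamma> i * (norm ((y - T z) $ i))\<^sup>2
        - 1 / \<gamma> i * (norm ((y - z) $ i))\<^sup>2) / 2 - g z $ i \<bullet> (y - T z) $ i" for i
    unfolding scaled_prox_inner[OF gamma_pos] unfolding inner_diff_polarization
    by (simp add: add_divide_distrib diff_divide_distrib)
  then have "(\<Sum>i\<in>UNIV. 1 / \<gamma> i * ((z $ i - \<gamma> i *\<^sub>R (g z $ i) - T z $ i) \<bullet> (y $ i - T z $ i)))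
    = (N (T z - z) + N (y - T z) - N (y - z)) / 2 - g z \<bullet> (y - T z)"
    unfolding wnorm_sq_def inner_vec_def
    by (simp only: sum_subtractf sum.distrib flip: sum_divide_distrib)
  with prox_ineq[OF assms] show ?thesis by simp
qed

text \<open>The comparison point \<open>y\<close> differs from \<open>T z\<close> in block
  \<open>i\<close> only, where it keeps \<open>z\<close>; this extracts a single-block inequality
  although \<open>\<sigma>\<close> is a modulus of the whole sum.\<close>

lemma component_decrease:
  assumes z: "z \<in> direct_sum D"
  shows "r i (T z $ i) - r i (z $ i) + g z $ i \<bullet> (T z - z) $ i + \<nu> i / 2 * (norm ((T z - z) $ i))\<^sup>2
    \<le> - (2 + \<sigma> - \<delta>) / 2 * (1 / \<gamma> i * (norm ((T z - z) $ i))\<^sup>2)"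
proof -
  define d where "d = (norm ((T z - z) $ i))\<^sup>2"
  define y where "y = (\<chi> j. if j = i then z $ j else T z $ j)"
  have y: "y \<in> direct_sum D" using z T_dom[OF z] by (auto simp: direct_sum_def y_def)
  have 1: "(\<Sum>j\<in>UNIV. r j (y $ j)) = (\<Sum>j\<in>UNIV. r j (T z $ j)) + (r i (z $ i) - r i (T z $ i))"
  proof -
    have "(\<Sum>j\<in>UNIV. r j (y $ j)) = (\<Sum>j\<in>UNIV. r j (T z $ j) + (if j = i then r i (z $ i) - r i (T z $ i) else 0))"
      by (rule sum.cong) (auto simp: y_def)
    then show ?thesis by (simp add: sum.distrib)
  qed
  have 2: "(\<Sum>j\<in>UNIV. 1 / \<gamma> j * ((z $ j - \<gamma> j *\<^sub>R (g z $ j) - T z $ j) \<bullet> (y $ j - T z $ j)))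
    = 1 / \<gamma> i * d + g z $ i \<bullet> (T z - z) $ i"
  proof -
    have "(\<Sum>j\<in>UNIV. 1 / \<gamma> j * ((z $ j - \<gamma> j *\<^sub>R (g z $ j) - T z $ j) \<bullet> (y $ j - T z $ j)))
      = (\<Sum>j\<in>UNIV. if j = i then 1 / \<gamma> i * ((z $ i - \<gamma> i *\<^sub>R (g z $ i) - T z $ i) \<bullet> (z $ i - T z $ i)) else 0)"
      by (rule sum.cong) (auto simp: y_def)
    also have "\<dots> = 1 / \<gamma> i * ((z $ i - \<gamma> i *\<^sub>R (g z $ i) - T z $ i) \<bullet> (z $ i - T z $ i))" by simp
    also have "\<dots> = 1 / \<gamma> i * d + g z $ i \<bullet> (T z - z) $ i"
      unfolding scaled_prox_inner[OF gamma_pos] unfolding inner_diff_polarization d_def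
      by (simp add: norm_minus_commute inner_diff_right)
    finally show ?thesis .
  qed
  have 3: "N (y - T z) = 1 / \<gamma> i * d"
  proof -
    have "N (y - T z) = (\<Sum>j\<in>UNIV. if j = i then 1 / \<gamma> i * d else 0)"
      unfolding wnorm_sq_def by (rule sum.cong) (auto simp: y_def d_def norm_minus_commute)
    then show ?thesis by simp
  qed
  have 4: "\<nu> i / 2 * d \<le> \<delta> / 2 * (1 / \<gamma> i * d)"
  proof -
    have "\<nu> i \<le> \<delta> * (1 / \<gamma> i)" using gamma_nu_le[of i] gamma_pos[of i] by (simp add: field_simps)
    from mult_right_mono[OF this, of d] show ?thesis by (simp add: d_def)
  qed
  define k where "k = 1 / \<gamma> i * d"
  show ?thesis
    using prox_ineq[OF z y] 4 unfolding 1 2 3 d_def[symmetric] k_def[symmetric] by (simp add: field_simps)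
qed

definition "decrease z = (\<Sum>i\<in>UNIV. r i (T z $ i) - r i (z $ i) + g z $ i \<bullet> (T z - z) $ i
  + \<nu> i / 2 * (norm ((T z - z) $ i))\<^sup>2)"

lemma decrease_le:
  assumes "z \<in> direct_sum D"
  shows "decrease z \<le> - (2 + \<sigma> - \<delta>) / 2 * N (T z - z)"
  unfolding decrease_def wnorm_sq_def sum_distrib_left
  by (rule sum_mono) (rule component_decrease[OF assms])

text \<open>Block \<open>i\<close> contributes with weight \<open>p i\<close>. Each contribution is
  nonpositive by \<open>component_decrease\<close>, so all weights may be lowered to
  \<open>p_min\<close>.\<close>

lemma expectation_F_step:
  assumes z: "z \<in> direct_sum D"
  shows "(\<Sum>e\<in>UNIV. q e * F (step z e)) \<le> F z + p_min * decrease z"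
proof -
  define b where "b = (\<lambda>i. r i (T z $ i) - r i (z $ i) + g z $ i \<bullet> (T z - z) $ i
    + \<nu> i / 2 * (norm ((T z - z) $ i))\<^sup>2)"
  have "(\<Sum>e\<in>UNIV. q e * (\<Sum>i\<in>UNIV. r i (step z e $ i)))
    = (\<Sum>e\<in>UNIV. q e * ((\<Sum>i\<in>UNIV. r i (z $ i)) + (\<Sum>i\<in>UNIV. of_bool (e i) * (r i (T z $ i) - r i (z $ i)))))"
    unfolding sum.distrib[symmetric] by (intro sum.cong refl arg_cong2[of _ _ _ _ "(*)"]) (auto simp: step_component)
  also have "\<dots> = (\<Sum>i\<in>UNIV. r i (z $ i)) + (\<Sum>i\<in>UNIV. p i * (r i (T z $ i) - r i (z $ i)))"
    by (rule expectation_mask)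
  finally have 1: "(\<Sum>e\<in>UNIV. q e * (\<Sum>i\<in>UNIV. r i (step z e $ i)))
    = (\<Sum>i\<in>UNIV. r i (z $ i)) + (\<Sum>i\<in>UNIV. p i * (r i (T z $ i) - r i (z $ i)))" .
  have "(\<Sum>e\<in>UNIV. q e * f (step z e)) \<le> f z + (\<Sum>i\<in>UNIV. p i * (g z $ i \<bullet> (T z - z) $ i))
      + 1 / 2 * (\<Sum>i\<in>UNIV. p i * \<nu> i * (norm ((T z - z) $ i))\<^sup>2)"
    using f_smooth[of z "T z - z"] dom_subset[OF z] diff_Hs[OF dom_subset[OF T_dom[OF z]] dom_subset[OF z]]
    unfolding step_def expectation_inner_mask by simp
  with 1 have "(\<Sum>e\<in>UNIV. q e * F (step z e)) \<le> F z + ((\<Sum>i\<in>UNIV. p i * (r i (T z $ i) - r i (z $ i)))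
      + (\<Sum>i\<in>UNIV. p i * (g z $ i \<bullet> (T z - z) $ i)) + 1 / 2 * (\<Sum>i\<in>UNIV. p i * \<nu> i * (norm ((T z - z) $ i))\<^sup>2))"
    unfolding F_def by (simp add: distrib_left sum.distrib)
  also have "(\<Sum>i\<in>UNIV. p i * (r i (T z $ i) - r i (z $ i)))
      + (\<Sum>i\<in>UNIV. p i * (g z $ i \<bullet> (T z - z) $ i)) + 1 / 2 * (\<Sum>i\<in>UNIV. p i * \<nu> i * (norm ((T z - z) $ i))\<^sup>2)
    = (\<Sum>i\<in>UNIV. p i * b i)"
    unfolding sum_distrib_left sum.distrib[symmetric] b_def by (rule sum.cong) (auto simp: algebra_simps)
  also have "(\<Sum>i\<in>UNIV. p i * b i) \<le> (\<Sum>i\<in>UNIV. p_min * b i)"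
  proof (rule sum_mono)
    fix i
    have "b i \<le> - (2 + \<sigma> - \<delta>) / 2 * (1 / \<gamma> i * (norm ((T z - z) $ i))\<^sup>2)"
      unfolding b_def by (rule component_decrease[OF z])
    also have "\<dots> \<le> 0" using sigma_nonneg delta_less gamma_pos[of i]
      by (intro mult_nonpos_nonneg) auto
    finally show "p i * b i \<le> p_min * b i" using p_min_le[of i] by (rule mult_right_mono_neg[rotated])
  qed
  finally show ?thesis unfolding decrease_def b_def sum_distrib_left by simp
qed

text \<open>The expected value after a step from \<open>xs\<close> cannot drop below the minimum, so \<open>xs\<close> is a fixed
  point of \<open>T\<close>; this replaces the first-order optimality condition.\<close>

lemma T_xs: "T xs = xs"
proof -
  have "F xs = (\<Sum>e\<in>UNIV. q e * F xs)" by (simp add: q_sum flip: sum_distrib_right)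
  also have "\<dots> \<le> (\<Sum>e\<in>UNIV. q e * F (step xs e))"
    using q_nonneg xs_min[OF step_dom[OF xs_dom]] by (intro sum_mono mult_left_mono) (auto simp: F_def)
  also have "\<dots> \<le> F xs + p_min * decrease xs" by (rule expectation_F_step[OF xs_dom])
  finally have "0 \<le> decrease xs" using p_min_pos by (simp add: zero_le_mult_iff)
  with decrease_le[OF xs_dom] have "(2 + \<sigma> - \<delta>) / 2 * N (T xs - xs) \<le> 0" by (simp add: algebra_simps)
  then have "N (T xs - xs) \<le> 0"
    using sigma_nonneg delta_less by (simp add: mult_le_0_iff)
  then have "N (T xs - xs) = 0" using N_nonneg by (simp add: order_antisym)
  then have "\<forall>i. 1 / \<gamma> i * (norm ((T xs - xs) $ i))\<^sup>2 = 0"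
    unfolding wnorm_sq_def using gamma_pos by (subst (asm) sum_nonneg_eq_0_iff) (auto simp: less_imp_le)
  then show ?thesis using gamma_pos by (simp add: vec_eq_iff less_imp_neq[symmetric]) 
qed

text \<open>Since \<open>xs\<close> is fixed by \<open>T\<close>, \<open>three_point\<close> there
  makes \<open>- g xs\<close> a subgradient of the nonsmooth part; adding \<open>f_strong\<close>
  cancels the gradient terms.\<close>

lemma F_quadratic_growth:
  assumes "z \<in> direct_sum D"
  shows "(\<mu> + \<sigma>) / 2 * N (z - xs) \<le> F z - F xs"
  using three_point[OF xs_dom assms] f_strong[OF dom_subset[OF xs_dom] dom_subset[OF assms]]
  unfolding T_xs F_def by (simp add: wnorm_sq_def field_simps)

text \<open>The direction \<open>T z - z\<close> is split through \<open>xs\<close>: strong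
  convexity of \<open>f\<close> handles the part from \<open>z\<close> to \<open>xs\<close>, and
  \<open>three_point\<close> with \<open>y = xs\<close> the remaining one.\<close>

lemma decrease_le_distance:
  assumes z: "z \<in> direct_sum D"
  shows "decrease z \<le> - (F z - F xs) + (1 - \<mu>) / 2 * N (z - xs) - (1 + \<sigma>) / 2 * N (T z - xs)
    + (\<delta> - 1) / 2 * N (T z - z)"
proof -
  have sym: "N (xs - v) = N (v - xs)" for v by (simp add: wnorm_sq_def norm_minus_commute)
  have "\<nu> i / 2 * d \<le> \<delta> / 2 * (1 / \<gamma> i * d)" if "d \<ge> 0" for i d
  proof -
    have "\<nu> i \<le> \<delta> * (1 / \<gamma> i)" using gamma_nu_le[of i] gamma_pos[of i] by (simp add: field_simps)
    from mult_right_mono[OF this that] show ?thesis by simp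
  qed
  then have "(\<Sum>i\<in>UNIV. \<nu> i / 2 * (norm ((T z - z) $ i))\<^sup>2) \<le> \<delta> / 2 * N (T z - z)"
    unfolding wnorm_sq_def sum_distrib_left by (intro sum_mono) auto
  then have "decrease z \<le> (\<Sum>i\<in>UNIV. r i (T z $ i)) - (\<Sum>i\<in>UNIV. r i (z $ i)) + g z \<bullet> (T z - z) + \<delta> / 2 * N (T z - z)"
    unfolding decrease_def inner_vec_def by (simp add: sum.distrib sum_subtractf)
  moreover have "g z \<bullet> (T z - z) = g z \<bullet> (xs - z) - g z \<bullet> (xs - T z)" by (simp add: inner_diff_right)
  moreover note three_point[OF z xs_dom] f_strong[OF dom_subset[OF z] dom_subset[OF xs_dom]]
  ultimately show ?thesis unfolding F_def sym by (simp add: field_simps)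
qed

text \<open>The factor \<open>1 / p i\<close> in the weights cancels the probability of updating
  block \<open>i\<close>, so the mean change is that of a full step in the
  unweighted-by-\<open>p\<close> norm \<open>N\<close>.\<close>

lemma expectation_distance_step:
  "(\<Sum>e\<in>UNIV. q e * wnorm_sq (\<lambda>i. 1 / (\<gamma> i * p i)) (step z e - xs))
    = wnorm_sq (\<lambda>i. 1 / (\<gamma> i * p i)) (z - xs) + (N (T z - xs) - N (z - xs))"
proof -
  define b where "b = (\<lambda>i. 1 / (\<gamma> i * p i) * ((norm ((T z - xs) $ i))\<^sup>2 - (norm ((z - xs) $ i))\<^sup>2))"
  have "wnorm_sq (\<lambda>i. 1 / (\<gamma> i * p i)) (step z e - xs)
      = wnorm_sq (\<lambda>i. 1 / (\<gamma> i * p i)) (z - xs) + (\<Sum>i\<in>UNIV. of_bool (e i) * b i)" for e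
    unfolding wnorm_sq_def b_def sum.distrib[symmetric]
    by (rule sum.cong) (auto simp: step_component right_diff_distrib)
  then have "(\<Sum>e\<in>UNIV. q e * wnorm_sq (\<lambda>i. 1 / (\<gamma> i * p i)) (step z e - xs))
      = wnorm_sq (\<lambda>i. 1 / (\<gamma> i * p i)) (z - xs) + (\<Sum>i\<in>UNIV. p i * b i)"
    by (simp only: expectation_mask)
  also have "(\<Sum>i\<in>UNIV. p i * b i) = N (T z - xs) - N (z - xs)"
    unfolding wnorm_sq_def b_def sum_subtractf[symmetric]
  proof (rule sum.cong)
    fix i
    have "p i * (1 / (\<gamma> i * p i)) = 1 / \<gamma> i" using p_pos[of i] by simp
    then show "p i * (1 / (\<gamma> i * p i) * ((norm ((T z - xs) $ i))\<^sup>2 - (norm ((z - xs) $ i))\<^sup>2))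
      = 1 / \<gamma> i * (norm ((T z - xs) $ i))\<^sup>2 - 1 / \<gamma> i * (norm ((z - xs) $ i))\<^sup>2"
      by (simp only: mult.assoc[symmetric] right_diff_distrib)
  qed simp
  finally show ?thesis .
qed

text \<open>Along a direction in block \<open>i\<close> alone, the averaged lower bound from strong
  convexity and the upper bound from smoothness share their first-order terms; comparing the
  quadratic ones gives \<open>\<mu> / \<gamma> i \<le> \<nu> i\<close>.\<close>

lemma mu_le_delta:
  assumes "w \<in> Hs i" "w \<noteq> 0"
  shows "\<mu> \<le> \<delta>"
proof -
  define v where "v = (\<chi> j. if j = i then w else 0)"
  have 0: "0 \<in> direct_sum Hs" and v: "v \<in> direct_sum Hs" and ev: "e \<odot> v \<in> direct_sum Hs" for e
    using subspace_Hs assms by (auto simp: direct_sum_def v_def mask_def subspace_0)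
  have comp: "(\<Sum>j\<in>UNIV. k j * (norm (v $ j))\<^sup>2) = k i * (norm w)\<^sup>2" for k :: "'m \<Rightarrow> real"
  proof -
    have "(\<Sum>j\<in>UNIV. k j * (norm (v $ j))\<^sup>2) = (\<Sum>j\<in>UNIV. if j = i then k i * (norm w)\<^sup>2 else 0)"
      by (rule sum.cong) (auto simp: v_def)
    then show ?thesis by simp
  qed
  have N_mask: "N (e \<odot> v) = (\<Sum>j\<in>UNIV. of_bool (e j) * (1 / \<gamma> j * (norm (v $ j))\<^sup>2))" for e
    unfolding wnorm_sq_def by (rule sum.cong) (auto simp: mask_def)
  have "(\<Sum>e\<in>UNIV. q e * (f 0 + g 0 \<bullet> (e \<odot> v) + \<mu> / 2 * N (e \<odot> v))) \<le> (\<Sum>e\<in>UNIV. q e * f (0 + e \<odot> v))"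
    using f_strong[OF 0 ev] q_nonneg by (intro sum_mono mult_left_mono) auto
  also have "\<dots> \<le> f 0 + (\<Sum>e\<in>UNIV. q e * (g 0 \<bullet> (e \<odot> v))) + 1 / 2 * (\<Sum>j\<in>UNIV. p j * \<nu> j * (norm (v $ j))\<^sup>2)"
    by (rule f_smooth[OF 0 v])
  also have "(\<Sum>e\<in>UNIV. q e * (f 0 + g 0 \<bullet> (e \<odot> v) + \<mu> / 2 * N (e \<odot> v)))
      = f 0 + (\<Sum>e\<in>UNIV. q e * (g 0 \<bullet> (e \<odot> v))) + \<mu> / 2 * (\<Sum>e\<in>UNIV. q e * N (e \<odot> v))"
    by (simp add: distrib_left sum.distrib sum_distrib_left mult_ac)
      (simp add: q_sum flip: sum_distrib_left)
  finally have "\<mu> * (\<Sum>e\<in>UNIV. q e * N (e \<odot> v)) \<le> (\<Sum>j\<in>UNIV. p j * \<nu> j * (norm (v $ j))\<^sup>2)" by simp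
  also have "(\<Sum>e\<in>UNIV. q e * N (e \<odot> v)) = (\<Sum>j\<in>UNIV. p j * (1 / \<gamma> j) * (norm (v $ j))\<^sup>2)"
    using expectation_mask[of 0 "\<lambda>j. 1 / \<gamma> j * (norm (v $ j))\<^sup>2"] unfolding N_mask by simp
  finally have "\<mu> * (p i * (1 / \<gamma> i) * (norm w)\<^sup>2) \<le> p i * \<nu> i * (norm w)\<^sup>2" unfolding comp .
  then have "(p i * (norm w)\<^sup>2) * (\<mu> / \<gamma> i) \<le> (p i * (norm w)\<^sup>2) * \<nu> i" by (simp add: mult_ac)
  then have "\<mu> / \<gamma> i \<le> \<nu> i" using p_pos[of i] assms by (subst (asm) mult_le_cancel_left_pos) auto
  then show ?thesis using gamma_pos[of i] gamma_nu_le[of i] by (simp add: field_simps)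
qed

lemma trivial_or_mu_le_delta: "\<mu> \<le> \<delta> \<or> (\<forall>z\<in>direct_sum D. z = xs)"
proof (cases "\<exists>i. \<exists>w\<in>Hs i. w \<noteq> 0")
  case True
  then show ?thesis using mu_le_delta by blast
next
  case False
  then have "z = 0" if "z \<in> direct_sum D" for z
    using dom_subset[OF that] by (auto simp: direct_sum_def vec_eq_iff)
  then show ?thesis using xs_dom by blast
qed

lemma lyapunov_step:
  assumes z: "z \<in> direct_sum D"
  shows "(\<Sum>e\<in>UNIV. q e * lyapunov (step z e)) \<le> (1 - p_min * lambda_bar \<delta> \<mu> \<sigma>) * lyapunov z"
proof (cases "\<mu> \<le> \<delta>")
  case False
  \<comment> \<open>The domain is now a single point, where the Lyapunov function vanishes.\<close>
  then have "z = xs" "\<And>e. step z e = xs" using trivial_or_mu_le_delta z step_dom[OF z] by blast+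
  then show ?thesis by (simp add: lyapunov_def wnorm_sq_def)
next
  case True
  define W where "W = wnorm_sq (\<lambda>i. 1 / (\<gamma> i * p i)) (z - xs)"
  define lam where "lam = lambda_bar \<delta> \<mu> \<sigma>"
  note par = delta_less mu_nonneg sigma_nonneg mu_sigma_pos True
  note lb = lambda_bar_bounds[OF par, folded c_def lam_def]
  have "(\<Sum>e\<in>UNIV. q e * lyapunov (step z e)) = (\<Sum>e\<in>UNIV. q e * F (step z e)) - F xs
      + p_min * c / 2 * (\<Sum>e\<in>UNIV. q e * wnorm_sq (\<lambda>i. 1 / (\<gamma> i * p i)) (step z e - xs))"
    unfolding lyapunov_def
    by (simp add: distrib_left right_diff_distrib sum.distrib sum_subtractf sum_distrib_left q_sum mult_ac
        flip: sum_distrib_right)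
  also have "\<dots> \<le> (F z + p_min * decrease z) - F xs + p_min * c / 2 * (W + (N (T z - xs) - N (z - xs)))"
    using expectation_F_step[OF z] unfolding expectation_distance_step W_def by simp
  also have "\<dots> = F z - F xs + p_min * c / 2 * W + p_min * (decrease z + c / 2 * (N (T z - xs) - N (z - xs)))"
    by (simp add: algebra_simps)
  also have "\<dots> \<le> F z - F xs + p_min * c / 2 * W + p_min * (- lam * (F z - F xs + c / 2 * N (z - xs)))"
    using descent_combination[OF par N_nonneg N_nonneg decrease_le_distance[OF z] decrease_le[OF z] F_quadratic_growth[OF z]]
      p_min_pos unfolding c_def lam_def by (intro add_left_mono mult_left_mono) auto
  \<comment> \<open>Passing from \<open>N\<close> to the weighted norm costs the ratio
    \<open>p_min / p i\<close>, at most 1 in each block.\<close>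
  also have "\<dots> \<le> F z - F xs + p_min * c / 2 * W + p_min * (- lam * (F z - F xs + c / 2 * (p_min * W)))"
  proof -
    have "p_min * W \<le> N (z - xs)" unfolding W_def wnorm_sq_def sum_distrib_left
    proof (rule sum_mono)
      fix i
      have "p_min * (1 / (\<gamma> i * p i)) \<le> 1 / \<gamma> i" using p_min_le[of i] p_pos[of i] gamma_pos[of i]
        by (simp add: field_simps)
      from mult_right_mono[OF this, of "(norm ((z - xs) $ i))\<^sup>2"]
      show "p_min * (1 / (\<gamma> i * p i) * (norm ((z - xs) $ i))\<^sup>2) \<le> 1 / \<gamma> i * (norm ((z - xs) $ i))\<^sup>2"
        by (simp add: mult.assoc)
    qed
    then have "lam * (c / 2 * (p_min * W)) \<le> lam * (c / 2 * N (z - xs))"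
      using lb(1,2) by (intro mult_left_mono) auto
    from mult_left_mono[OF this, of p_min] show ?thesis using p_min_pos by (simp add: algebra_simps)
  qed
  also have "\<dots> = (1 - p_min * lam) * lyapunov z"
    unfolding lyapunov_def W_def by (simp add: field_simps)
  finally show ?thesis unfolding lam_def .
qed

text \<open>Iterating the one-step contraction multiplies an inequality by the rate, which therefore
  must not be negative.\<close>

lemma rate_nonneg:
  assumes "\<mu> \<le> \<delta>"
  shows "0 \<le> 1 - p_min * lambda_bar \<delta> \<mu> \<sigma>"
proof -
  note lb = lambda_bar_bounds[OF delta_less mu_nonneg sigma_nonneg mu_sigma_pos assms]
  have "p i \<le> (\<Sum>e\<in>UNIV. q e)" for i
    unfolding p_eq using q_nonneg by (intro sum_mono) auto
  then have "p_min \<le> 1" using p_min_le q_sum by (metis order_trans)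
  then have "p_min * lambda_bar \<delta> \<mu> \<sigma> \<le> 1 * 1"
    using lb(2) order_trans[OF lb(3,4)] p_min_pos by (intro mult_mono) auto
  then show ?thesis by simp
qed

lemma F_gap_le_lyapunov:
  assumes "z \<in> direct_sum D"
  shows "F z - F xs \<le> lyapunov z"
proof -
  have "0 \<le> c" using delta_less sigma_nonneg by (auto simp: c_def)
  then show ?thesis unfolding lyapunov_def
    using p_min_pos p_pos gamma_pos by (simp add: wnorm_sq_nonneg less_imp_le)
qed

end

subsection \<open>Expectations along the random trajectory\<close>

context prob_space
begin

text \<open>Because \<open>X\<close> is discrete, every \<open>G\<close> is admissible;
  measurability of the objective or of the proximal map never has to be shown.\<close>

lemma integrable_finite_range:
  fixes G :: "'b \<Rightarrow> real"
  assumes X: "X \<in> measurable M (count_space UNIV)" and fin: "finite (X ` space M)"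
  shows "integrable M (\<lambda>\<omega>. G (X \<omega>))"
proof (rule integrable_const_bound)
  show "AE \<omega> in M. norm (G (X \<omega>)) \<le> Max ((\<lambda>y. norm (G y)) ` X ` space M)"
    using fin by (intro AE_I2 Max_ge) auto
  show "(\<lambda>\<omega>. G (X \<omega>)) \<in> borel_measurable M"
    by (rule measurable_compose[OF X]) simp
qed

lemma expectation_finite_rv:
  fixes X :: "'a \<Rightarrow> 'b::finite" and G :: "'b \<Rightarrow> real"
  assumes X: "X \<in> measurable M (count_space UNIV)"
  shows "expectation (\<lambda>\<omega>. G (X \<omega>)) = (\<Sum>e\<in>UNIV. prob {\<omega>\<in>space M. X \<omega> = e} * G e)"
proof -
  have S: "{\<omega>\<in>space M. X \<omega> = e} \<in> events" for e
  proof -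
    have "{\<omega>\<in>space M. X \<omega> = e} = X -` {e} \<inter> space M" by auto
    then show ?thesis using measurable_sets[OF X, of "{e}"] by simp
  qed
  have "expectation (\<lambda>\<omega>. G (X \<omega>)) = expectation (\<lambda>\<omega>. \<Sum>e\<in>UNIV. indicator {\<omega>\<in>space M. X \<omega> = e} \<omega> * G e)"
    by (rule Bochner_Integration.integral_cong) (auto simp: indicator_def if_distrib[of "\<lambda>x. x * _"] cong: if_cong)
  also have "\<dots> = (\<Sum>e\<in>UNIV. prob {\<omega>\<in>space M. X \<omega> = e} * G e)"
    using S by (subst Bochner_Integration.integral_sum) (auto simp: emeasure_eq_measure Int_absorb1)
  finally show ?thesis .
qed

text \<open>\<open>N\<close> is arbitrary and only indices below \<open>n\<close> are constrained,
  so that this applies to the probability space and to the product space of the first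
  \<open>n\<close> masks alike.\<close>

lemma measurable_history:
  fixes X :: "nat \<Rightarrow> 'c \<Rightarrow> 'b::countable"
  assumes "\<And>k. k < n \<Longrightarrow> X k \<in> measurable N (count_space UNIV)"
  shows "(\<lambda>\<omega>. map (\<lambda>k. X k \<omega>) [0..<n]) \<in> measurable N (count_space UNIV)"
  using assms
proof (induction n)
  case (Suc n)
  then have [measurable]: "(\<lambda>\<omega>. map (\<lambda>k. X k \<omega>) [0..<n]) \<in> measurable N (count_space UNIV)"
    "X n \<in> measurable N (count_space UNIV)"
    by simp_all
  show ?case by simp
qed simp

text \<open>The two sides depend on the disjoint index sets \<open>{..<n}\<close> and
  \<open>{n}\<close>.\<close>

lemma indep_history_next:
  fixes X :: "nat \<Rightarrow> 'a \<Rightarrow> 'b::countable" and A :: "'b list \<Rightarrow> real" and B :: "'b \<Rightarrow> real"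
  assumes "indep_vars (\<lambda>_. count_space UNIV) X UNIV"
  shows "indep_var borel (\<lambda>\<omega>. A (map (\<lambda>k. X k \<omega>) [0..<n])) borel (\<lambda>\<omega>. B (X n \<omega>))"
proof -
  have 1: "indep_var (PiM {..<n} (\<lambda>_. count_space UNIV)) (\<lambda>\<omega>. \<lambda>i\<in>{..<n}. X i \<omega>)
      (PiM {n} (\<lambda>_. count_space UNIV)) (\<lambda>\<omega>. \<lambda>i\<in>{n}. X i \<omega>)"
    by (rule indep_var_restrict[OF assms]) auto
  have "(\<lambda>h. map h [0..<n]) \<in> measurable (PiM {..<n} (\<lambda>_. count_space UNIV)) (count_space (UNIV :: 'b list set))"
    by (rule measurable_history) (auto intro!: measurable_component_singleton)
  then have 2: "(\<lambda>h. A (map h [0..<n])) \<in> borel_measurable (PiM {..<n} (\<lambda>_. count_space UNIV))"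
    by (rule measurable_compose) simp
  have "(\<lambda>h. h n) \<in> measurable (PiM {n} (\<lambda>_. count_space UNIV)) (count_space (UNIV :: 'b set))"
    by (intro measurable_component_singleton) auto
  then have 3: "(\<lambda>h. B (h n)) \<in> borel_measurable (PiM {n} (\<lambda>_. count_space UNIV))"
    by (rule measurable_compose) simp
  have "(\<lambda>h. A (map h [0..<n])) \<circ> (\<lambda>\<omega>. \<lambda>i\<in>{..<n}. X i \<omega>) = (\<lambda>\<omega>. A (map (\<lambda>k. X k \<omega>) [0..<n]))"
    "(\<lambda>h. B (h n)) \<circ> (\<lambda>\<omega>. \<lambda>i\<in>{n}. X i \<omega>) = (\<lambda>\<omega>. B (X n \<omega>))"
    by (auto simp: fun_eq_iff intro!: arg_cong[of _ _ A])
  then show ?thesis using indep_var_compose[OF 1 2 3] by simp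
qed

lemma finite_history_range:
  fixes X :: "nat \<Rightarrow> 'a \<Rightarrow> 'b::finite"
  shows "finite ((\<lambda>\<omega>. map (\<lambda>k. X k \<omega>) [0..<n]) ` S)"
  by (rule finite_subset[OF _ finite_lists_length_eq[of UNIV n]]) auto

text \<open>Stands in for conditioning on the history: \<open>G\<close> is split over the values
  \<open>e\<close> of the next variable, and independence factors each product with the indicator of
  \<open>X n = e\<close>.\<close>

lemma expectation_next:
  fixes X :: "nat \<Rightarrow> 'a \<Rightarrow> 'b::{finite,countable}" and G :: "'b list \<Rightarrow> 'b \<Rightarrow> real"
  assumes indep: "indep_vars (\<lambda>_. count_space UNIV) X UNIV"
  shows "expectation (\<lambda>\<omega>. G (map (\<lambda>k. X k \<omega>) [0..<n]) (X n \<omega>))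
    = expectation (\<lambda>\<omega>. \<Sum>e\<in>UNIV. prob {\<omega>\<in>space M. X n \<omega> = e} * G (map (\<lambda>k. X k \<omega>) [0..<n]) e)"
proof -
  let ?h = "\<lambda>\<omega>. map (\<lambda>k. X k \<omega>) [0..<n]"
  have Xk: "X k \<in> measurable M (count_space UNIV)" for k
    using indep by (simp add: indep_vars_def)
  have h: "?h \<in> measurable M (count_space UNIV)"
    by (rule measurable_history[OF Xk])
  have int_h: "integrable M (\<lambda>\<omega>. G (?h \<omega>) e)" for e
    by (rule integrable_finite_range[OF h finite_history_range])
  have int_X: "integrable M (\<lambda>\<omega>. of_bool (X n \<omega> = e) :: real)" for e
    by (rule integrable_finite_range[OF Xk]) (auto intro: finite_subset[OF subset_UNIV])
  have ind_e: "indep_var borel (\<lambda>\<omega>. G (?h \<omega>) e) borel (\<lambda>\<omega>. of_bool (X n \<omega> = e) :: real)" for e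
    by (rule indep_history_next[OF indep, of "\<lambda>l. G l e" n "\<lambda>y. of_bool (y = e)"])
  have prod: "expectation (\<lambda>\<omega>. G (?h \<omega>) e * of_bool (X n \<omega> = e))
      = expectation (\<lambda>\<omega>. G (?h \<omega>) e) * prob {\<omega>\<in>space M. X n \<omega> = e}" for e
  proof -
    have "expectation (\<lambda>\<omega>. of_bool (X n \<omega> = e)) = (\<Sum>y\<in>UNIV. prob {\<omega>\<in>space M. X n \<omega> = y} * of_bool (y = e))"
      by (rule expectation_finite_rv[OF Xk])
    also have "\<dots> = prob {\<omega>\<in>space M. X n \<omega> = e}" by (simp add: of_bool_def if_distrib cong: if_cong)
    finally show ?thesis using indep_var_lebesgue_integral[OF ind_e int_h int_X, of e] by simp
  qed
  have "expectation (\<lambda>\<omega>. G (?h \<omega>) (X n \<omega>)) = expectation (\<lambda>\<omega>. \<Sum>e\<in>UNIV. G (?h \<omega>) e * of_bool (X n \<omega> = e))"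
    by (rule Bochner_Integration.integral_cong) (auto simp: of_bool_def if_distrib cong: if_cong)
  also have "\<dots> = (\<Sum>e\<in>UNIV. expectation (\<lambda>\<omega>. G (?h \<omega>) e) * prob {\<omega>\<in>space M. X n \<omega> = e})"
    by (subst Bochner_Integration.integral_sum)
      (auto simp: prod intro!: indep_var_integrable[OF ind_e int_h int_X])
  also have "\<dots> = expectation (\<lambda>\<omega>. \<Sum>e\<in>UNIV. prob {\<omega>\<in>space M. X n \<omega> = e} * G (?h \<omega>) e)"
    using int_h by (subst Bochner_Integration.integral_sum) (auto simp: mult.commute)
  finally show ?thesis .
qed

end

lemma ereal_expectation_ereal:
  assumes "integrable M g" and "\<And>\<omega>. \<omega> \<in> space M \<Longrightarrow> X \<omega> = ereal (g \<omega>)"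
  shows "ereal_expectation M X = ereal (\<integral>\<omega>. g \<omega> \<partial>M)"
proof -
  have e: "(\<integral>\<^sup>+\<omega>. e2ennreal (X \<omega>) \<partial>M) = (\<integral>\<^sup>+\<omega>. ennreal (g \<omega>) \<partial>M)"
    "(\<integral>\<^sup>+\<omega>. e2ennreal (- X \<omega>) \<partial>M) = (\<integral>\<^sup>+\<omega>. ennreal (- g \<omega>) \<partial>M)"
    using assms(2) by (auto intro!: nn_integral_cong)
  obtain a b where "0 \<le> a" "(\<integral>\<^sup>+\<omega>. ennreal (g \<omega>) \<partial>M) = ennreal a"
    "0 \<le> b" "(\<integral>\<^sup>+\<omega>. ennreal (- g \<omega>) \<partial>M) = ennreal b" "(\<integral>\<omega>. g \<omega> \<partial>M) = a - b"
    using integrableE[OF assms(1)] by metis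
  then show ?thesis unfolding ereal_expectation_def e by simp
qed

subsection \<open>Linear convergence\<close>

theorem theorem4p10:
  fixes Hs :: "'m::finite \<Rightarrow> 'a::real_inner set"
    and H :: "('a ^ 'm) set"
    and f :: "'a ^ 'm \<Rightarrow> real"
    and hs :: "'m \<Rightarrow> 'a \<Rightarrow> ereal"
    and h F :: "'a ^ 'm \<Rightarrow> ereal"
    and M :: "'w measure"
    and \<epsilon> :: "'w \<Rightarrow> 'm \<Rightarrow> bool"
    and \<epsilon>s :: "nat \<Rightarrow> 'w \<Rightarrow> 'm \<Rightarrow> bool"
    and p \<nu> \<gamma> :: "'m \<Rightarrow> real"
    and x0 xstar :: "'a ^ 'm"
    and x :: "nat \<Rightarrow> 'w \<Rightarrow> 'a ^ 'm"
    and \<delta> p_min \<mu> \<sigma> :: real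
    and F_star :: ereal
  assumes Hs: "\<And>i. separable_hilbert (Hs i)"
    and H: "H = direct_sum Hs"
    and f_convex: "convex_on H f"
    and f_diff: "f differentiable_on H"
    and hs_proper: "\<And>i. proper_on (Hs i) (hs i)"
    and hs_convex: "\<And>i. ereal_convex_on (Hs i) (hs i)"
    and hs_lsc: "\<And>i. lsc_on (Hs i) (hs i)"
    and h: "h = (\<lambda>z. \<Sum>i\<in>UNIV. hs i (z $ i))"
    and F: "F = (\<lambda>z. ereal (f z) + h z)"
    and M: "prob_space M"
    and eps_rv: "\<epsilon> \<in> measurable M (count_space UNIV)"
    and p: "\<And>i. p i = \<P>(\<omega> in M. \<epsilon> \<omega> i)"
    and p_pos: "\<And>i. 0 < p i"
    and eps_nonzero: "\<P>(\<omega> in M. \<epsilon> \<omega> = (\<lambda>i. False)) = 0"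
    and eps_indep: "prob_space.indep_vars M (\<lambda>n. count_space UNIV) \<epsilon>s UNIV"
    and eps_copies: "\<And>n. distr M (count_space UNIV) (\<epsilon>s n) = distr M (count_space UNIV) \<epsilon>"
    and nu_pos: "\<And>i. 0 < \<nu> i"
    and smooth: "\<And>z v. z \<in> H \<Longrightarrow> v \<in> H \<Longrightarrow>
          (\<integral>\<omega>. f (z + \<epsilon> \<omega> \<odot> v) \<partial>M)
            \<le> f z + (\<integral>\<omega>. gradient_on H f z \<bullet> (\<epsilon> \<omega> \<odot> v) \<partial>M)
                + 1 / 2 * (\<Sum>i\<in>UNIV. p i * \<nu> i * (norm (v $ i))\<^sup>2)"
    and gamma: "\<And>i. 0 < \<gamma> i \<and> \<gamma> i < 2 / \<nu> i"
    and x0: "x0 \<in> H" "h x0 < \<infinity>"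
    and x_0: "\<And>\<omega>. \<omega> \<in> space M \<Longrightarrow> x 0 \<omega> = x0"
    and x_Suc: "\<And>n \<omega> i. \<omega> \<in> space M \<Longrightarrow>
          x (Suc n) \<omega> $ i = x n \<omega> $ i + of_bool (\<epsilon>s n \<omega> i) *\<^sub>R
            (prox_on (Hs i) (\<lambda>z. ereal (\<gamma> i) * hs i z)
               (x n \<omega> $ i - \<gamma> i *\<^sub>R (gradient_on H f (x n \<omega>) $ i)) - x n \<omega> $ i)"
    and delta: "\<delta> = Max (range (\<lambda>i. \<gamma> i * \<nu> i))"
    and p_min: "p_min = Min (range p)"
    and F_star: "F_star = (INF z\<in>H. F z)"
    and mu: "smooth_strong_convexity_modulus H (\<lambda>i. 1 / \<gamma> i) f \<mu>"
    and sigma: "strong_convexity_modulus H (\<lambda>i. 1 / \<gamma> i) h \<sigma>"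
    and mu_sigma: "\<mu> + \<sigma> > 0"
    and argmin: "{z. is_arg_min F (\<lambda>y. y \<in> H) z} = {xstar}"
  shows "\<forall>n. ereal_expectation M (\<lambda>\<omega>. F (x n \<omega>)) - F_star
          \<le> ereal ((1 - p_min * lambda_bar \<delta> \<mu> \<sigma>) ^ n) *
             (ereal (p_min * (1 + \<sigma> - max (\<delta> - 1) 0)
                * (wnorm_sq (\<lambda>i. 1 / (\<gamma> i * p i)) (x0 - xstar) / 2))
              + F x0 - F_star)"
proof -
  interpret prob_space M by (rule M)
  define D where "D = (\<lambda>i. {z\<in>Hs i. hs i z \<noteq> \<infinity>})"
  define r where "r = (\<lambda>i z. real_of_ereal (hs i z))"
  define g where "g = gradient_on H f"
  define T where "T = (\<lambda>z. \<chi> i. prox_on (Hs i) (\<lambda>u. ereal (\<gamma> i) * hs i u) (z $ i - \<gamma> i *\<^sub>R (g z $ i)))"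
  define q where "q = (\<lambda>e. prob {\<omega>\<in>space M. \<epsilon> \<omega> = e})"
  define hr where "hr = (\<lambda>z. \<Sum>i\<in>UNIV. r i (z $ i))"
  have sub: "subspace (Hs i)" and comp: "Topological_Spaces.complete (Hs i)" for i
    using Hs[of i] by (auto simp: separable_hilbert_def)
  have gpos: "0 < \<gamma> i" for i using gamma by blast
  have h_dom: "h z = ereal (hr z)" if "z \<in> direct_sum D" for z
  proof -
    have "hs i (z $ i) = ereal (r i (z $ i))" for i
      using that finite_on_domain[OF hs_proper[of i], of "z $ i"] by (auto simp: direct_sum_def D_def r_def)
    then show ?thesis unfolding h hr_def by simp
  qed
  have h_ndom: "h z = \<infinity>" if "z \<in> H" "z \<notin> direct_sum D" for z
    using that unfolding h H direct_sum_def D_def by (auto simp: sum_Pinfty)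
  have DH: "z \<in> H" if "z \<in> direct_sum D" for z
    using that unfolding H direct_sum_def D_def by auto
  have T_D: "T z \<in> direct_sum D" for z
    using prox_on_subgradient_inequality(1,2)[OF Hs hs_proper hs_convex hs_lsc gpos]
    by (auto simp: T_def direct_sum_def D_def)
  \<comment> \<open>The modulus \<open>\<sigma>\<close> belongs to \<open>h\<close> as a whole, so
    the blockwise proximal inequalities are first assembled into one subgradient \<open>v\<close> of
    \<open>h\<close> at \<open>T z\<close>.\<close>
  have prox: "hr (T z) + (\<Sum>i\<in>UNIV. 1 / \<gamma> i * ((z $ i - \<gamma> i *\<^sub>R (g z $ i) - T z $ i) \<bullet> (y $ i - T z $ i)))
        + \<sigma> / 2 * wnorm_sq (\<lambda>i. 1 / \<gamma> i) (y - T z) \<le> hr y" if y: "y \<in> direct_sum D" for z y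
  proof -
    define u where "u = (\<lambda>i. z $ i - \<gamma> i *\<^sub>R (g z $ i))"
    \<comment> \<open>Subgradients must lie in the carrier; projecting puts them there without knowing that the
      gradient, defined by \<open>THE\<close>, does.\<close>
    have "\<exists>v. v \<in> Hs i \<and> (\<forall>y\<in>Hs i. v \<bullet> y = ((1 / \<gamma> i) *\<^sub>R (u i - T z $ i)) \<bullet> y)" for i
      using complete_subspace_projection[OF sub comp] by metis
    then obtain v' where v': "\<And>i. v' i \<in> Hs i"
      "\<And>i y. y \<in> Hs i \<Longrightarrow> v' i \<bullet> y = ((1 / \<gamma> i) *\<^sub>R (u i - T z $ i)) \<bullet> y" by metis
    define v where "v = (\<chi> i. v' i)"
    have vH: "v \<in> H" using v' by (simp add: H direct_sum_def v_def)
    have v_inner: "v \<bullet> (w - T z) = (\<Sum>i\<in>UNIV. 1 / \<gamma> i * ((u i - T z $ i) \<bullet> (w $ i - T z $ i)))" if "w \<in> H" for w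
    proof -
      have "w $ i - T z $ i \<in> Hs i" for i
        using that DH[OF T_D[of z]] sub by (auto simp: H direct_sum_def subspace_diff)
      then show ?thesis using v'(2) by (simp add: inner_vec_def v_def)
    qed
    have "v \<in> subdifferential_on H h (T z)"
      unfolding subdifferential_on_def
    proof (intro CollectI conjI ballI vH)
      fix w assume w: "w \<in> H"
      show "h (T z) + ereal (v \<bullet> (w - T z)) \<le> h w"
      proof (cases "w \<in> direct_sum D")
        case True
        have "r i (T z $ i) + 1 / \<gamma> i * ((u i - T z $ i) \<bullet> (w $ i - T z $ i)) \<le> r i (w $ i)" for i
          using prox_on_subgradient_inequality(3)[OF Hs[of i] hs_proper hs_convex hs_lsc gpos[of i], of "w $ i" "u i"] True
          by (auto simp: r_def T_def u_def direct_sum_def D_def)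
        then have "hr (T z) + v \<bullet> (w - T z) \<le> hr w"
          unfolding v_inner[OF w] hr_def sum.distrib[symmetric] by (intro sum_mono)
        then show ?thesis using h_dom[OF T_D] h_dom[OF True] by simp
      qed (use h_ndom[OF w] in simp)
    qed
    with sigma DH[OF T_D] DH[OF y]
    have "h (T z) + ereal (v \<bullet> (y - T z)) + ereal (\<sigma> / 2 * wnorm_sq (\<lambda>i. 1 / \<gamma> i) (y - T z)) \<le> h y"
      unfolding strong_convexity_modulus_def by blast
    then show ?thesis using h_dom[OF T_D] h_dom[OF y] v_inner[OF DH[OF y]] by (simp add: u_def)
  qed
  have E_eps: "(\<integral>\<omega>. G (\<epsilon> \<omega>) \<partial>M) = (\<Sum>e\<in>UNIV. q e * G e)" for G :: "('m \<Rightarrow> bool) \<Rightarrow> real"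
    unfolding q_def by (rule expectation_finite_rv[OF eps_rv])
  have xs_arg: "xstar \<in> H" "\<And>y. y \<in> H \<Longrightarrow> F xstar \<le> F y"
    using argmin by (auto simp: is_arg_min_linorder set_eq_iff)
  have F_dom: "F z = ereal (f z + hr z)" if "z \<in> direct_sum D" for z
    using h_dom[OF that] by (simp add: F)
  have x0D: "x0 \<in> direct_sum D" using h_ndom[of x0] x0 by auto
  have xsD: "xstar \<in> direct_sum D"
  proof (rule ccontr)
    assume "xstar \<notin> direct_sum D"
    then have "F xstar = \<infinity>" using h_ndom[OF xs_arg(1)] by (simp add: F)
    then show False using xs_arg(2)[OF x0(1)] F_dom[OF x0D] by simp
  qed
  have Fs: "F_star = F xstar"
    unfolding F_star using xs_arg by (intro antisym INF_lower INF_greatest) auto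
  have delta_range: "\<delta> \<in> range (\<lambda>i. \<gamma> i * \<nu> i)" unfolding delta by (rule Max_in) auto
  have d2: "\<delta> < 2"
  proof -
    obtain i where "\<delta> = \<gamma> i * \<nu> i" using delta_range by auto
    then show ?thesis using gamma[of i] nu_pos[of i] by (simp add: field_simps)
  qed
  have pm: "0 < p_min" "\<And>i. p_min \<le> p i"
    using p_pos Min_in[of "range p"] unfolding p_min by auto
  interpret L: block_prox_descent Hs D r f g T q p \<nu> \<gamma> \<delta> \<mu> \<sigma> p_min xstar
  proof
    show "subspace (Hs i)" for i by (rule sub)
    show "D i \<subseteq> Hs i" for i by (auto simp: D_def)
    show "0 \<le> q e" for e by (simp add: q_def)
    show "(\<Sum>e\<in>UNIV. q e) = 1" using E_eps[of "\<lambda>_. 1"] by (simp add: prob_space)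
    show "p i = (\<Sum>e\<in>UNIV. q e * of_bool (e i))" for i
    proof -
      have S: "{\<omega>\<in>space M. \<epsilon> \<omega> i} \<in> events"
      proof -
        have "{\<omega>\<in>space M. \<epsilon> \<omega> i} = \<epsilon> -` {e. e i} \<inter> space M" by auto
        then show ?thesis using measurable_sets[OF eps_rv, of "{e. e i}"] by simp
      qed
      have "p i = (\<integral>\<omega>. indicator {\<omega>\<in>space M. \<epsilon> \<omega> i} \<omega> \<partial>M)"
        unfolding p using S by (simp add: Int_absorb1)
      also have "\<dots> = (\<integral>\<omega>. of_bool (\<epsilon> \<omega> i) \<partial>M)"
        by (rule Bochner_Integration.integral_cong) auto
      also have "\<dots> = (\<Sum>e\<in>UNIV. q e * of_bool (e i))" by (rule E_eps)
      finally show ?thesis .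
    qed
    show "0 < p_min" "p_min \<le> p i" for i using pm by auto
    show "0 < \<gamma> i" for i by (rule gpos)
    show "\<gamma> i * \<nu> i \<le> \<delta>" for i unfolding delta by (rule Max_ge) auto
    show "\<delta> < 2" by (rule d2)
    show "0 \<le> \<mu>" "0 \<le> \<sigma>" using mu sigma
      by (auto simp: smooth_strong_convexity_modulus_def strong_convexity_modulus_def)
    show "0 < \<mu> + \<sigma>" by (rule mu_sigma)
    show "T z \<in> direct_sum D" for z by (rule T_D)
    show "(\<Sum>i\<in>UNIV. r i (T z $ i))
        + (\<Sum>i\<in>UNIV. 1 / \<gamma> i * ((z $ i - \<gamma> i *\<^sub>R (g z $ i) - T z $ i) \<bullet> (y $ i - T z $ i)))
        + \<sigma> / 2 * wnorm_sq (\<lambda>i. 1 / \<gamma> i) (y - T z) \<le> (\<Sum>i\<in>UNIV. r i (y $ i))"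
      if "y \<in> direct_sum D" for z y
      using prox[OF that] unfolding hr_def .
    show "f z + g z \<bullet> (y - z) + \<mu> / 2 * wnorm_sq (\<lambda>i. 1 / \<gamma> i) (y - z) \<le> f y"
      if "z \<in> direct_sum Hs" "y \<in> direct_sum Hs" for z y
      using mu that unfolding smooth_strong_convexity_modulus_def g_def H by blast
    show "(\<Sum>e\<in>UNIV. q e * f (z + e \<odot> v))
        \<le> f z + (\<Sum>e\<in>UNIV. q e * (g z \<bullet> (e \<odot> v))) + 1 / 2 * (\<Sum>i\<in>UNIV. p i * \<nu> i * (norm (v $ i))\<^sup>2)"
      if "z \<in> direct_sum Hs" "v \<in> direct_sum Hs" for z v
      using smooth[of z v] that unfolding g_def H
      by (simp only: E_eps[of "\<lambda>e. f (z + e \<odot> v)"] E_eps[of "\<lambda>e. gradient_on (direct_sum Hs) f z \<bullet> (e \<odot> v)"])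
    show "xstar \<in> direct_sum D" by (rule xsD)
    show "f xstar + (\<Sum>i\<in>UNIV. r i (xstar $ i)) \<le> f z + (\<Sum>i\<in>UNIV. r i (z $ i))" if "z \<in> direct_sum D" for z
      using xs_arg(2)[OF DH[OF that]] F_dom[OF that] F_dom[OF xsD] by (simp add: hr_def)
  qed
  have LF: "F z = ereal (L.F z)" if "z \<in> direct_sum D" for z
    using F_dom[OF that] by (simp add: L.F_def hr_def)
  define hist where "hist = (\<lambda>n \<omega>. map (\<lambda>k. \<epsilon>s k \<omega>) [0..<n])"
  \<comment> \<open>The iterate becomes a deterministic function of the finite list of masks drawn
    so far; \<open>foldl\<close> applies the newest mask last.\<close>
  define X where "X = foldl L.step x0"
  have X_D: "X es \<in> direct_sum D" for es
    unfolding X_def by (induction es rule: rev_induct) (auto simp: x0D L.step_dom)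
  have x_hist: "x n \<omega> = X (hist n \<omega>)" if "\<omega> \<in> space M" for n \<omega>
  proof (induction n)
    case 0
    then show ?case using x_0[OF that] by (simp add: X_def hist_def)
  next
    case (Suc n)
    have "x (Suc n) \<omega> = L.step (x n \<omega>) (\<epsilon>s n \<omega>)"
      unfolding vec_eq_iff L.step_def mask_def using x_Suc[OF that] by (simp add: T_def g_def)
    then show ?case using Suc by (simp add: X_def hist_def)
  qed
  have eps_n_rv: "\<epsilon>s n \<in> measurable M (count_space UNIV)" for n
    using eps_indep by (simp add: indep_vars_def)
  have hist_rv: "hist n \<in> measurable M (count_space UNIV)" for n
    unfolding hist_def by (rule measurable_history[OF eps_n_rv])
  have int: "integrable M (\<lambda>\<omega>. G (hist n \<omega>))" for G :: "('m \<Rightarrow> bool) list \<Rightarrow> real" and n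
    using integrable_finite_range[OF hist_rv] finite_history_range unfolding hist_def by blast
  \<comment> \<open>The smoothness hypothesis concerns \<open>\<epsilon>\<close> alone; equality of
    laws carries it to every step.\<close>
  have q_n: "prob {\<omega>\<in>space M. \<epsilon>s n \<omega> = e} = q e" for n e
  proof -
    have "measure (distr M (count_space UNIV) (\<epsilon>s n)) {e} = measure (distr M (count_space UNIV) \<epsilon>) {e}"
      by (simp only: eps_copies)
    moreover have "\<epsilon>s n -` {e} \<inter> space M = {\<omega>\<in>space M. \<epsilon>s n \<omega> = e}"
      "\<epsilon> -` {e} \<inter> space M = {\<omega>\<in>space M. \<epsilon> \<omega> = e}" by auto
    ultimately show ?thesis
      using eps_n_rv[of n] eps_rv by (simp add: measure_distr q_def)
  qed
  define \<rho> where "\<rho> = 1 - p_min * lambda_bar \<delta> \<mu> \<sigma>"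
  define V where "V = (\<lambda>n. expectation (\<lambda>\<omega>. L.lyapunov (X (hist n \<omega>))))"
  have V0: "V 0 = L.lyapunov x0" by (simp add: V_def X_def hist_def prob_space)
  have V_Suc: "V (Suc n) \<le> \<rho> * V n" for n
  proof -
    have "V (Suc n) = expectation (\<lambda>\<omega>. L.lyapunov (L.step (X (hist n \<omega>)) (\<epsilon>s n \<omega>)))"
      by (simp add: V_def X_def hist_def)
    also have "\<dots> = expectation (\<lambda>\<omega>. \<Sum>e\<in>UNIV. q e * L.lyapunov (L.step (X (hist n \<omega>)) e))"
      using expectation_next[OF eps_indep, of "\<lambda>l e. L.lyapunov (L.step (X l) e)" n]
      unfolding hist_def q_n .
    also have "\<dots> \<le> expectation (\<lambda>\<omega>. \<rho> * L.lyapunov (X (hist n \<omega>)))"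
      unfolding \<rho>_def
      by (rule integral_mono[OF int[of "\<lambda>l. \<Sum>e\<in>UNIV. q e * L.lyapunov (L.step (X l) e)"] int[of "\<lambda>l. _ * L.lyapunov (X l)"]])
        (rule L.lyapunov_step[OF X_D])
    finally show ?thesis by (simp add: V_def)
  qed
  \<comment> \<open>Induction works when the rate is nonnegative, which
    \<open>\<mu> \<le> \<delta>\<close> ensures; otherwise the domain is one point and both sides
    are 0.\<close>
  have V_bound: "V n \<le> \<rho> ^ n * L.lyapunov x0" for n
  proof (cases "\<mu> \<le> \<delta>")
    case True
    then have "0 \<le> \<rho>" unfolding \<rho>_def by (rule L.rate_nonneg)
    then show ?thesis
    proof (induction n)
      case (Suc n)
      have "V (Suc n) \<le> \<rho> * V n" by (rule V_Suc)
      also have "\<dots> \<le> \<rho> * (\<rho> ^ n * L.lyapunov x0)" using Suc by (intro mult_left_mono) auto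
      finally show ?case by simp
    qed (simp add: V0)
  next
    case False
    then have "z = xstar" if "z \<in> direct_sum D" for z using L.trivial_or_mu_le_delta that by blast
    moreover have "L.lyapunov xstar = 0" by (simp add: L.lyapunov_def wnorm_sq_def)
    ultimately have "L.lyapunov z = 0" if "z \<in> direct_sum D" for z
      using that by metis
    then show ?thesis using X_D x0D by (simp add: V_def)
  qed
  show ?thesis
  proof
    fix n
    \<comment> \<open>The trajectory stays in the domain, where \<open>F\<close> is finite, so the
      extended expectation is an ordinary integral.\<close>
    have E: "ereal_expectation M (\<lambda>\<omega>. F (x n \<omega>)) = ereal (expectation (\<lambda>\<omega>. L.F (X (hist n \<omega>))))"
      by (rule ereal_expectation_ereal[OF int[of "\<lambda>l. L.F (X l)"]]) (simp add: x_hist LF[OF X_D])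
    have "expectation (\<lambda>\<omega>. L.F (X (hist n \<omega>))) - L.F xstar = expectation (\<lambda>\<omega>. L.F (X (hist n \<omega>)) - L.F xstar)"
      using int[of "\<lambda>l. L.F (X l)"] by (simp add: prob_space)
    also have "\<dots> \<le> V n"
      unfolding V_def
      by (rule integral_mono[OF int[of "\<lambda>l. L.F (X l) - L.F xstar"] int[of "\<lambda>l. L.lyapunov (X l)"]])
        (rule L.F_gap_le_lyapunov[OF X_D])
    also have "\<dots> \<le> \<rho> ^ n * L.lyapunov x0" by (rule V_bound)
    finally show "ereal_expectation M (\<lambda>\<omega>. F (x n \<omega>)) - F_star
          \<le> ereal ((1 - p_min * lambda_bar \<delta> \<mu> \<sigma>) ^ n) *
             (ereal (p_min * (1 + \<sigma> - max (\<delta> - 1) 0)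
                * (wnorm_sq (\<lambda>i. 1 / (\<gamma> i * p i)) (x0 - xstar) / 2))
              + F x0 - F_star)"
      unfolding E Fs LF[OF xsD] LF[OF x0D] L.lyapunov_def L.c_def \<rho>_def by (simp add: algebra_simps)
  qed
qed

end
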